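(* Let $\mathcal{M}$ be a uniform oriented matroid of rank $r\ge 2$ on $n$ elements with $n-r\le 4$. Then $\operatorname{diam}(G^*(\mathcal{M}))=n-r+2$.
   Context: Sign vectors: for a finite set $E$ and $X\in\{+,-,0\}^E$, write $X^+=\{e:X_e=+\}$, $X^-=\{e:X_e=-\}$, $X^0=\{e:X_e=0\}$, $\operatorname{supp}(X)=X^+\cup X^-$, and $-X$ for the componentwise negation. For sign vectors $X,Y$, the separating set is $S(X,Y)=(X^+\cap Y^-)\cup(X^-\cap Y^+)$, and the composition $X\circ Y$ is given by $(X\circ Y)_e=X_e$ if $X_e\neq 0$ and $(X\circ Y)_e=Y_e$ otherwise. An oriented matroid $\mathcal{M}=(E,\mathcal{C}^* )$ is a finite set $E$ together with a set $\mathcal{C}^*\subseteq\{+,-,0\}^E$ of (signed) cocircuits satisfying: (CC0) $\mathbf{0}\notin\mathcal{C}^*$; (CC1) $X\in\mathcal{C}^*\Rightarrow -X\in\mathcal{C}^*$; (CC2) if $X,Y\in\mathcal{C}^*$ and $\operatorname{supp}(X)\subseteq\operatorname{supp}(Y)$ then $X=\pm Y$; (CC3) if $X,Y\in\mathcal{C}^*$, $X\neq -Y$ and $e\in S(X,Y)$, then there is $Z\in\mathcal{C}^*$ with $Z^+\subseteq (X^+\cup Y^+)\setminus\{e\}$ and $Z^-\subseteq (X^-\cup Y^-)\setminus\{e\}$. The covectors of $\mathcal{M}$ are $\mathbf{0}$ together with all compositions $X^1\circ\cdots\circ X^k$ ($k\ge 1$) of cocircuits, partially ordered componentwise by $0<+$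 and $0<-$ ($+,-$ incomparable). The rank $r$ of $\mathcal{M}$ is the largest $k$ such that there is a chain $\mathbf{0}=V_0<V_1<\cdots<V_k$ of covectors. $\mathcal{M}$ is uniform if $|X^0|=r-1$ for every cocircuit $X$. The cocircuit graph $G^*(\mathcal{M})$ has the cocircuits as vertices, with distinct cocircuits $X,Y$ adjacent iff $|X^0\cap Y^0|\ge r-2$ and $S(X,Y)=\emptyset$. $\operatorname{diam}(G^*(\mathcal{M}))$ is the maximum graph distance between two cocircuits. *)

theory Defs
  imports Main "HOL-Library.Extended_Nat"
begin

datatype sign = Pos | Neg | Zer

type_synonym 'a signvec = "'a \<Rightarrow> sign"

definition signvecs :: "'a set \<Rightarrow> 'a signvec set" where
  "signvecs E = {X. \<forall>e. e \<notin> E \<longrightarrow> X e = Zer}"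

definition zerovec :: "'a signvec" where "zerovec = (\<lambda>e. Zer)"

definition negsv :: "sign \<Rightarrow> sign" where
  "negsv s = (case s of Pos \<Rightarrow> Neg | Neg \<Rightarrow> Pos | Zer \<Rightarrow> Zer)"

definition neg :: "'a signvec \<Rightarrow> 'a signvec" where "neg X = (\<lambda>e. negsv (X e))"

definition posp :: "'a signvec \<Rightarrow> 'a set" where "posp X = {e. X e = Pos}"
definition negp :: "'a signvec \<Rightarrow> 'a set" where "negp X = {e. X e = Neg}"
definition zerop :: "'a set \<Rightarrow> 'a signvec \<Rightarrow> 'a set" where "zerop E X = {e\<in>E. X e = Zer}"
definition supp :: "'a signvec \<Rightarrow> 'a set" where "supp X = posp X \<union> negp X"

definition sep :: "'a signvec \<Rightarrow> 'a signvec \<Rightarrow> 'a set" where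
  "sep X Y = (posp X \<inter> negp Y) \<union> (negp X \<inter> posp Y)"

definition comp :: "'a signvec \<Rightarrow> 'a signvec \<Rightarrow> 'a signvec" where
  "comp X Y = (\<lambda>e. if X e \<noteq> Zer then X e else Y e)"

definition oriented_matroid :: "'a set \<Rightarrow> 'a signvec set \<Rightarrow> bool" where
  "oriented_matroid E C \<longleftrightarrow> finite E \<and> C \<subseteq> signvecs E \<and>
     zerovec \<notin> C \<and>
     (\<forall>X\<in>C. neg X \<in> C) \<and>
     (\<forall>X\<in>C. \<forall>Y\<in>C. supp X \<subseteq> supp Y \<longrightarrow> X = Y \<or> X = neg Y) \<and>
     (\<forall>X\<in>C. \<forall>Y\<in>C. \<forall>e. X \<noteq> neg Y \<and> e \<in> sep X Y \<longrightarrow>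
        (\<exists>Z\<in>C. posp Z \<subseteq> (posp X \<union> posp Y) - {e} \<and> negp Z \<subseteq> (negp X \<union> negp Y) - {e}))"

definition covectors :: "'a signvec set \<Rightarrow> 'a signvec set" where
  "covectors C = insert zerovec {foldr comp Xs zerovec | Xs. Xs \<noteq> [] \<and> set Xs \<subseteq> C}"

definition sv_le :: "'a signvec \<Rightarrow> 'a signvec \<Rightarrow> bool" where
  "sv_le X Y \<longleftrightarrow> (\<forall>e. X e = Zer \<or> X e = Y e)"

definition sv_less :: "'a signvec \<Rightarrow> 'a signvec \<Rightarrow> bool" where
  "sv_less X Y \<longleftrightarrow> sv_le X Y \<and> X \<noteq> Y"

definition has_chain :: "'a signvec set \<Rightarrow> nat \<Rightarrow> bool" where
  "has_chain C k \<longleftrightarrow> (\<exists>V :: nat \<Rightarrow> 'a signvec. V 0 = zerovec \<and>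
      (\<forall>i\<le>k. V i \<in> covectors C) \<and> (\<forall>i<k. sv_less (V i) (V (Suc i))))"

definition om_rank :: "'a signvec set \<Rightarrow> nat" where
  "om_rank C = (GREATEST k. has_chain C k)"

definition uniform_om :: "'a set \<Rightarrow> 'a signvec set \<Rightarrow> bool" where
  "uniform_om E C \<longleftrightarrow> (\<forall>X\<in>C. card (zerop E X) = om_rank C - 1)"

definition cocircuit_adj :: "'a set \<Rightarrow> 'a signvec set \<Rightarrow> 'a signvec \<Rightarrow> 'a signvec \<Rightarrow> bool" where
  "cocircuit_adj E C X Y \<longleftrightarrow> X \<in> C \<and> Y \<in> C \<and> X \<noteq> Y \<and>
     card (zerop E X \<inter> zerop E Y) \<ge> om_rank C - 2 \<and> sep X Y = {}"

definition is_walk :: "'a set \<Rightarrow> 'a signvec set \<Rightarrow> 'a signvec \<Rightarrow> 'a signvec \<Rightarrow> nat \<Rightarrow> bool" where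
  "is_walk E C X Y k \<longleftrightarrow> (\<exists>p :: nat \<Rightarrow> 'a signvec. p 0 = X \<and> p k = Y \<and>
      (\<forall>i<k. cocircuit_adj E C (p i) (p (Suc i))))"

text \<open>Graph distance in the cocircuit graph (infinity if not connected).\<close>
definition cg_dist :: "'a set \<Rightarrow> 'a signvec set \<Rightarrow> 'a signvec \<Rightarrow> 'a signvec \<Rightarrow> enat" where
  "cg_dist E C X Y = (INF k \<in> {k. is_walk E C X Y k}. enat k)"

definition cg_diam :: "'a set \<Rightarrow> 'a signvec set \<Rightarrow> enat" where
  "cg_diam E C = (SUP X\<in>C. SUP Y\<in>C. cg_dist E C X Y)"

end

theory Submission
  imports Defs
begin

text \<open>Put \<open>d = n - r\<close>; the supports of the cocircuits are exactly the \<open>(d + 1)\<close>-subsets of \<open>E\<close>. Two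
  cocircuits whose supports differ in one element lie on a line, and their distance is at most one
  plus the number of separating elements. For the lower bound, on the way from \<open>X\<close> to \<open>- X\<close> each of
  the \<open>d + 1\<close> elements of the support must become zero, at most one per step, and one more step is
  needed to leave the last of these zeros.

  For the upper bound let \<open>k\<close> be the number of elements of \<open>supp Y - supp X\<close>, so \<open>k \<le> d + 1 \<le> 5\<close>. For
  \<open>k = 2\<close> there are two opposite corners through which one can walk from \<open>X\<close> to \<open>Y\<close>, and no element
  is crossed superfluously on both routes; with \<open>s\<close> separating elements this gives a path of length at
  most \<open>s + 2 + (d - 1 - s) div 2\<close>. Larger \<open>k\<close> are reduced to \<open>k = 2\<close> by pivots from \<open>X\<close> towards \<open>Y\<close>
  and from \<open>Y\<close> towards \<open>X\<close>, chosen to separate as little as possible.\<close>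

text \<open>The bound \<open>d \<le> 4\<close> acts through the number
  \<open>(d - 1 - s) div 2\<close>. It also sets the budget for \<open>k \<ge> 3\<close>: when
  \<open>d = 4\<close>, a plane costs three steps if nothing separates its two ends and four if one
  or two elements do, so of the six steps allowed only three or two remain for pivots. For
  \<open>k = 5\<close> all three are consumed and no separating element may be created. The obstacle
  is a pivot whose leaving element is the wrong one; \<open>line_triangle\<close> restricts where
  single pivots can end, and \<open>simplex\<close> shows that not all of them can end badly. The
  rank is defined by chains of covectors, so it is not immediate that every
  \<open>(d + 1)\<close>-subset is a support. This is derived in the last part by an elimination in
  echelon form.\<close>

lemma supp_iff [simp]: "e \<in> supp X \<longleftrightarrow> X e \<noteq> Zer"
  by (cases "X e") (auto simp: supp_def posp_def negp_def)

lemma sep_iff [simp]: "e \<in> sep X Y \<longleftrightarrow> X e \<noteq> Zer \<and> Y e \<noteq> Zer \<and> X e \<noteq> Y e"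
  by (cases "X e"; cases "Y e") (auto simp: sep_def posp_def negp_def)

lemma sep_commute: "sep X Y = sep Y X"
  by auto

lemma negsv_simps [simp]:
  "negsv s = Zer \<longleftrightarrow> s = Zer" "negsv (negsv s) = s" "negsv s = negsv t \<longleftrightarrow> s = t"
  by (cases s; cases t; simp add: negsv_def)+

lemma negsv_Zer [simp]: "negsv Zer = Zer"
  by simp

lemma eq_negsv_iff: "s \<noteq> Zer \<Longrightarrow> t \<noteq> Zer \<Longrightarrow> s = negsv t \<longleftrightarrow> s \<noteq> t"
  by (cases s; cases t) (auto simp: negsv_def)

lemma negsv_eq_iff: "s \<noteq> Zer \<Longrightarrow> t \<noteq> Zer \<Longrightarrow> negsv s = t \<longleftrightarrow> s \<noteq> t"
  by (cases s; cases t) (auto simp: negsv_def)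

lemma sign_two: "r \<noteq> Zer \<Longrightarrow> s \<noteq> Zer \<Longrightarrow> t \<noteq> Zer \<Longrightarrow> r \<noteq> s \<Longrightarrow> t \<noteq> s \<Longrightarrow> r = t"
  by (cases r; cases s; cases t) auto

lemma neg_apply [simp]: "neg X e = negsv (X e)"
  by (simp add: neg_def)

lemma neg_neg [simp]: "neg (neg X) = X"
  by (rule ext) simp

lemma supp_neg [simp]: "supp (neg X) = supp X"
  by auto

subsection \<open>Lines and pivots\<close>

text \<open>An interface free of covectors and chains. Since all supports have the same size,
  \<open>same_supp\<close> says as much as (CC2). The lemma \<open>uniform\<close> establishes these
  assumptions with \<open>d = card E - om_rank C\<close>.\<close>

locale uniform_cocircuits =
  fixes E :: "'a set" and C :: "'a signvec set" and d :: nat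
  assumes finite_E: "finite E"
    and supp_subset: "X \<in> C \<Longrightarrow> supp X \<subseteq> E"
    and neg_closed: "X \<in> C \<Longrightarrow> neg X \<in> C"
    and same_supp: "X \<in> C \<Longrightarrow> Y \<in> C \<Longrightarrow> supp X = supp Y \<Longrightarrow> X = Y \<or> X = neg Y"
    and card_supp: "X \<in> C \<Longrightarrow> card (supp X) = Suc d"
    and ex_supp: "S \<subseteq> E \<Longrightarrow> card S = Suc d \<Longrightarrow> \<exists>X\<in>C. supp X = S"
    and weak_elim: "X \<in> C \<Longrightarrow> Y \<in> C \<Longrightarrow> X \<noteq> neg Y \<Longrightarrow> e \<in> sep X Y \<Longrightarrow>
      \<exists>Z\<in>C. posp Z \<subseteq> (posp X \<union> posp Y) - {e} \<and> negp Z \<subseteq> (negp X \<union> negp Y) - {e}"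
    and card_E: "card E = d + om_rank C"
    and rank_ge_2: "2 \<le> om_rank C"
begin

lemma finite_supp: "X \<in> C \<Longrightarrow> finite (supp X)"
  using finite_E supp_subset finite_subset by blast

lemma finite_sep:
  assumes "X \<in> C"
  shows "finite (sep X Y)"
  using finite_supp[OF assms] by (rule rev_finite_subset) auto

lemma weak_elimE:
  assumes "X \<in> C" "Y \<in> C" "X \<noteq> neg Y" "e \<in> sep X Y"
  obtains Z where "Z \<in> C" "Z e = Zer" "\<And>f. Z f \<noteq> Zer \<Longrightarrow> Z f = X f \<or> Z f = Y f"
proof -
  obtain Z where Z: "Z \<in> C" "posp Z \<subseteq> (posp X \<union> posp Y) - {e}"
      "negp Z \<subseteq> (negp X \<union> negp Y) - {e}"
    using weak_elim[OF assms] by blast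
  show thesis
  proof
    show "Z \<in> C" by fact
    show "Z e = Zer" using Z by (cases "Z e") (auto simp: posp_def negp_def)
    show "Z f = X f \<or> Z f = Y f" if "Z f \<noteq> Zer" for f
      using Z that by (cases "Z f") (auto simp: posp_def negp_def)
  qed
qed

lemma eq_if_agree:
  assumes "X \<in> C" "Y \<in> C" "supp X = supp Y" "X e = Y e" "X e \<noteq> Zer"
  shows "X = Y"
  using same_supp[OF assms(1-3)] assms(4,5) eq_negsv_iff[of "X e" "Y e"] by auto

lemma ex_supp_sign:
  assumes "S \<subseteq> E" "card S = Suc d" "e \<in> S" "s \<noteq> Zer"
  obtains X where "X \<in> C" "supp X = S" "X e = s"
proof -
  obtain X where X: "X \<in> C" "supp X = S"
    using ex_supp assms by blast
  show thesis
  proof (cases "X e = s")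
    case True
    with X that show thesis by blast
  next
    case False
    moreover have "X e \<noteq> Zer"
      using X(2) assms(3) by auto
    ultimately have "neg X e = s"
      using assms(4) negsv_eq_iff by simp
    with X neg_closed that[of "neg X"] show thesis by simp
  qed
qed

text \<open>On a line weak elimination is already exact: the support of \<open>Z\<close> has
  \<open>d + 1\<close> elements and lies in the union without \<open>e\<close>, which has just as
  many. So \<open>Z\<close> is the point where the segment from \<open>X\<close> to \<open>Y\<close>
  meets the hyperplane of \<open>e\<close>.\<close>

lemma line_elim:
  assumes X: "X \<in> C" and Y: "Y \<in> C" and U: "card (supp X \<union> supp Y) = Suc (Suc d)"
    and e: "e \<in> sep X Y"
  obtains Z where "Z \<in> C" "supp Z = supp X \<union> supp Y - {e}"
    "\<And>f. X f \<noteq> Zer \<Longrightarrow> f \<notin> sep X Y \<Longrightarrow> Z f = X f"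
    "\<And>f. Y f \<noteq> Zer \<Longrightarrow> f \<notin> sep X Y \<Longrightarrow> Z f = Y f"
proof -
  have "X \<noteq> neg Y"
    using U card_supp[OF X] by auto
  from weak_elimE[OF X Y this e] obtain Z where Z: "Z \<in> C" "Z e = Zer"
    "\<And>f. Z f \<noteq> Zer \<Longrightarrow> Z f = X f \<or> Z f = Y f" by metis
  have "supp Z = supp X \<union> supp Y - {e}"
  proof (rule card_subset_eq)
    show "finite (supp X \<union> supp Y - {e})"
      using X Y finite_supp by simp
    show "supp Z \<subseteq> supp X \<union> supp Y - {e}"
      using Z(2,3) by fastforce
    show "card (supp Z) = card (supp X \<union> supp Y - {e})"
      using U e card_supp[OF Z(1)] by simp
  qed
  moreover from this have "Z f \<noteq> Zer" if "f \<notin> sep X Y" "X f \<noteq> Zer \<or> Y f \<noteq> Zer" for f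
    using that e by (metis DiffI UnCI singletonD supp_iff)
  ultimately show thesis
    using that[OF Z(1)] Z(3) by (metis sep_iff)
qed

section \<open>Walks of bounded length\<close>

definition reach :: "'a signvec \<Rightarrow> 'a signvec \<Rightarrow> nat \<Rightarrow> bool" where
  "reach X Y k \<longleftrightarrow> (\<exists>j\<le>k. (cocircuit_adj E C ^^ j) X Y)"

lemma reach_refl: "reach X X k"
  unfolding reach_def by (rule exI[of _ 0]) simp

lemma reach_mono: "reach X Y j \<Longrightarrow> j \<le> k \<Longrightarrow> reach X Y k"
  unfolding reach_def by (meson le_trans)

lemma reach_trans: "reach X Y j \<Longrightarrow> reach Y Z k \<Longrightarrow> reach X Z (j + k)"
  unfolding reach_def by (meson add_mono relpowp_trans)

lemma reach_sym: "reach X Y k \<Longrightarrow> reach Y X k"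
proof -
  have "(cocircuit_adj E C ^^ j) Y X" if "(cocircuit_adj E C ^^ j) X Y" for j
    using that
  proof (induction j arbitrary: Y)
    case (Suc j)
    then obtain Z where "(cocircuit_adj E C ^^ j) X Z" "cocircuit_adj E C Z Y"
      by auto
    moreover from this have "cocircuit_adj E C Y Z"
      by (auto simp: cocircuit_adj_def sep_commute[of Y Z] Int_commute)
    ultimately show ?case
      using Suc.IH by (metis relpowp_Suc_I2)
  qed simp
  then show "reach X Y k \<Longrightarrow> reach Y X k"
    unfolding reach_def by blast
qed

lemma reach_adj:
  assumes X: "X \<in> C" and Y: "Y \<in> C" and U: "card (supp X \<union> supp Y) = Suc (Suc d)"
    and "sep X Y = {}"
  shows "reach X Y 1"
proof -
  have "zerop E X \<inter> zerop E Y = E - (supp X \<union> supp Y)"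
    by (auto simp: zerop_def)
  then have "card (zerop E X \<inter> zerop E Y) = om_rank C - 2"
    using U card_E supp_subset[OF X] supp_subset[OF Y] finite_supp[OF X] finite_supp[OF Y]
    by (simp add: card_Diff_subset)
  moreover have "X \<noteq> Y"
    using U card_supp[OF X] by auto
  ultimately have "cocircuit_adj E C X Y"
    using assms by (simp add: cocircuit_adj_def)
  then show ?thesis
    unfolding reach_def by (metis One_nat_def le_refl relpowp_1)
qed

text \<open>Cut the segment at the hyperplane of a separating element \<open>e\<close>. Every other
  separating element belongs to at most one of the two pieces, and \<open>e\<close> to neither, so
  the gain of one pays for the additional segment.\<close>

lemma reach_line:
  assumes "X \<in> C" "Y \<in> C" "card (supp X \<union> supp Y) = Suc (Suc d)"
  shows "reach X Y (Suc (card (sep X Y)))"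
  using assms
proof (induction "card (sep X Y)" arbitrary: X Y rule: less_induct)
  case less
  show ?case
  proof (cases "sep X Y = {}")
    case True
    then show ?thesis using reach_adj[OF less.prems] by simp
  next
    case False
    then obtain e where e: "e \<in> sep X Y" by blast
    obtain Z where Z: "Z \<in> C" "supp Z = supp X \<union> supp Y - {e}"
      "\<And>f. X f \<noteq> Zer \<Longrightarrow> f \<notin> sep X Y \<Longrightarrow> Z f = X f"
      "\<And>f. Y f \<noteq> Zer \<Longrightarrow> f \<notin> sep X Y \<Longrightarrow> Z f = Y f"
      using line_elim[OF less.prems e] by metis
    have fin: "finite (sep X Y)"
      using less.prems(1) by (rule finite_sep)
    have Ze: "Z e = Zer"
      using Z(2) supp_iff[of e Z] by auto
    have sub: "sep X Z \<union> sep Z Y \<subseteq> sep X Y - {e}"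
    proof
      fix f assume f: "f \<in> sep X Z \<union> sep Z Y"
      then have "f \<noteq> e" using Ze by auto
      moreover have "f \<in> sep X Y"
        using f Z(3)[of f] Z(4)[of f] by auto
      ultimately show "f \<in> sep X Y - {e}" by blast
    qed
    have disj: "sep X Z \<inter> sep Z Y = {}"
    proof (rule equals0I)
      fix f assume f: "f \<in> sep X Z \<inter> sep Z Y"
      then have "X f = Y f"
        using sign_two[of "X f" "Z f" "Y f"] by auto
      moreover have "f \<in> sep X Y"
        using f sub by blast
      ultimately show False by simp
    qed
    have card: "card (sep X Z) + card (sep Z Y) < card (sep X Y)"
    proof -
      have "finite (sep X Z)" "finite (sep Z Y)"
        using sub fin by (meson finite_Diff finite_subset le_sup_iff)+
      then have "card (sep X Z) + card (sep Z Y) = card (sep X Z \<union> sep Z Y)"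
        using card_Un_disjoint disj by metis
      also have "\<dots> \<le> card (sep X Y - {e})"
        using sub fin by (meson card_mono finite_Diff)
      also have "\<dots> < card (sep X Y)"
        using e fin by (meson card_Diff1_less)
      finally show ?thesis .
    qed
    have "e \<in> supp X" "e \<in> supp Y"
      using e by auto
    then have "supp X \<union> supp Z = supp X \<union> supp Y" "supp Z \<union> supp Y = supp X \<union> supp Y"
      unfolding Z(2) by blast+
    then have "reach X Z (Suc (card (sep X Z)))" "reach Z Y (Suc (card (sep Z Y)))"
      using less.hyps[of X Z] less.hyps[of Z Y] card less.prems Z(1) by auto
    from reach_trans[OF this] show ?thesis
      by (rule reach_mono) (use card in simp)
  qed
qed

text \<open>As each cocircuit may be negated, this says that the product of the three agreement signs of
  cocircuits on a line is always negative.\<close>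

lemma line_triangle:
  assumes Z: "Z1 \<in> C" "Z2 \<in> C" "Z3 \<in> C"
    and U: "card U = Suc (Suc d)" "u1 \<in> U" "u2 \<in> U" "u3 \<in> U" "u1 \<noteq> u2" "u1 \<noteq> u3" "u2 \<noteq> u3"
    and supp: "supp Z1 = U - {u1}" "supp Z2 = U - {u2}" "supp Z3 = U - {u3}"
    and eq: "Z1 u3 = Z2 u3" "Z1 u2 = Z3 u2"
  shows "Z2 u1 \<noteq> Z3 u1"
proof
  assume eq3: "Z2 u1 = Z3 u1"
  have nz: "Z1 u2 \<noteq> Zer" "Z1 u3 \<noteq> Zer" "Z2 u1 \<noteq> Zer" "Z2 u3 \<noteq> Zer" "Z1 u1 = Zer" "Z2 u2 = Zer"
    using supp U by (metis Diff_iff singletonD insertI1 supp_iff)+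
  have un: "supp Z1 \<union> supp (neg Z2) = U"
    using supp U by auto
  \<comment> \<open>Eliminating \<open>u3\<close> from \<open>Z1\<close> and \<open>neg Z2\<close>
    gives a cocircuit on the support of \<open>Z3\<close>. Its sign at \<open>u2\<close> comes from
    \<open>Z1\<close>, which makes it \<open>Z3\<close>; its sign at \<open>u1\<close> comes from
    \<open>neg Z2\<close>, which contradicts \<open>eq3\<close>.\<close>
  have "u3 \<in> sep Z1 (neg Z2)"
    using nz eq eq_negsv_iff by auto
  then obtain V where V: "V \<in> C" "supp V = U - {u3}"
    "\<And>f. Z1 f \<noteq> Zer \<Longrightarrow> f \<notin> sep Z1 (neg Z2) \<Longrightarrow> V f = Z1 f"
    "\<And>f. neg Z2 f \<noteq> Zer \<Longrightarrow> f \<notin> sep Z1 (neg Z2) \<Longrightarrow> V f = neg Z2 f"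
    using line_elim[OF Z(1) neg_closed[OF Z(2)], of u3] un U(1) by metis
  have "V u2 = Z3 u2"
    using V(3)[of u2] nz eq by simp
  then have "V = Z3"
    using eq_if_agree[OF V(1) Z(3), of u2] V(2) supp nz eq by simp
  then have "V u1 = Z2 u1" using eq3 by simp
  moreover have "V u1 = negsv (Z2 u1)"
    using V(4)[of u1] nz by simp
  ultimately show False using nz eq_negsv_iff[of "Z2 u1" "Z2 u1"] by simp
qed

text \<open>Follow the line on which \<open>b\<close> leaves zero with sign \<open>s\<close> up to
  the first element of \<open>A\<close>; elements of the support outside \<open>A\<close> may be
  crossed on the way. "First" is expressed by minimality: if some \<open>f\<close> in
  \<open>A\<close> still separated, stopping at \<open>f\<close> would separate fewer elements of
  \<open>A\<close>.\<close>

lemma pivot: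
  assumes X: "X \<in> C" and b: "b \<in> E" "b \<notin> supp X" and s: "s \<noteq> Zer"
    and A: "A \<subseteq> supp X" "A \<noteq> {}"
  obtains Z a where "Z \<in> C" "a \<in> A" "supp Z = insert b (supp X) - {a}" "Z b = s"
    "\<And>f. f \<in> A \<Longrightarrow> f \<noteq> a \<Longrightarrow> Z f = X f"
proof -
  define good where "good = (\<lambda>(Z, a). Z \<in> C \<and> a \<in> A \<and> supp Z = insert b (supp X) - {a} \<and> Z b = s)"
  define m where "m = (\<lambda>(Z, a::'a). card (sep X Z \<inter> A))"
  obtain a0 where a0: "a0 \<in> A"
    using A by blast
  have "insert b (supp X) - {a0} \<subseteq> E"
    using b supp_subset[OF X] by auto
  moreover have "card (insert b (supp X) - {a0}) = Suc d"
    using a0 A b card_supp[OF X] finite_supp[OF X] by (subst card_Diff_singleton) (auto simp del: supp_iff)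
  ultimately obtain Z0 where "Z0 \<in> C" "supp Z0 = insert b (supp X) - {a0}" "Z0 b = s"
    using ex_supp_sign[of "insert b (supp X) - {a0}" b s] b s a0 A by blast
  then have "good (Z0, a0)"
    using a0 by (simp add: good_def)
  then obtain p where p: "good p" "\<And>q. good q \<Longrightarrow> m p \<le> m q"
    using ex_has_least_nat[of good "(Z0, a0)" m] by blast
  obtain Z a where [simp]: "p = (Z, a)"
    by (cases p)
  have Z: "Z \<in> C" "a \<in> A" "supp Z = insert b (supp X) - {a}" "Z b = s"
    using p(1) by (auto simp: good_def)
  have "Z f = X f" if f: "f \<in> A" "f \<noteq> a" for f
  proof (rule ccontr)
    assume ne: "Z f \<noteq> X f"
    have fX: "f \<in> supp X" "f \<noteq> b"
      using f A b by auto
    have sep: "f \<in> sep X Z"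
      using fX f Z(3) ne by (metis Diff_iff insertCI sep_iff singletonD supp_iff)
    have un: "supp X \<union> supp Z = insert b (supp X)"
      using Z(2,3) A by auto
    then have "card (supp X \<union> supp Z) = Suc (Suc d)"
      using b card_supp[OF X] finite_supp[OF X] by simp
    then obtain V where V: "V \<in> C" "supp V = supp X \<union> supp Z - {f}"
      "\<And>g. X g \<noteq> Zer \<Longrightarrow> g \<notin> sep X Z \<Longrightarrow> V g = X g"
      "\<And>g. Z g \<noteq> Zer \<Longrightarrow> g \<notin> sep X Z \<Longrightarrow> V g = Z g"
      using line_elim[OF X Z(1) _ sep] by metis
    have "V b = s"
      using V(4)[of b] Z(4) s b by auto
    then have "good (V, f)"
      using V(1,2) f un by (simp add: good_def)
    moreover have "sep X V \<inter> A \<subset> sep X Z \<inter> A"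
    proof
      show "sep X V \<inter> A \<subseteq> sep X Z \<inter> A"
        using V(3) by fastforce
      have "V f = Zer"
        using V(2) supp_iff by fast
      then have "f \<notin> sep X V" by simp
      then show "sep X V \<inter> A \<noteq> sep X Z \<inter> A"
        using sep f by blast
    qed
    then have "m (V, f) < m (Z, a)"
      unfolding m_def using A finite_supp[OF X]
      by (simp add: psubset_card_mono finite_subset)
    ultimately show False
      using p(2)[of "(V, f)"] by simp
  qed
  with Z that show thesis by blast
qed

text \<open>Geometrically: if every edge at a vertex of a tope ends in the same facet, then the tope is a
  simplex, so it has no vertex off the remaining hyperplanes.\<close>

lemma simplex:
  assumes S: "card S = d" "finite S" "s0 \<in> S" "\<sigma> \<noteq> Zer" and B: "B \<inter> S = {}" "finite B"
    and Z: "\<And>b. b \<in> B \<Longrightarrow> \<exists>Z\<in>C. supp Z = insert b S \<and> Z s0 = \<sigma> \<and> Z b = Y b"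
    and Y: "Y \<in> C" "supp Y \<subseteq> S \<union> B" "Y s0 = Zer"
  shows False
proof -
  \<comment> \<open>Descent from \<open>Y\<close>: the entries on \<open>B\<close> are removed one
    by one by elimination against the negative of the given cocircuit at \<open>b\<close>, whose
    only nonzero entry in \<open>B\<close> is \<open>b\<close>. That negative has the sign opposite
    to \<open>\<sigma>\<close> at \<open>s0\<close>, so \<open>\<sigma>\<close> never appears there.
    At the end the support would lie in \<open>S\<close>, which has only \<open>d\<close>
    elements.\<close>
  define good where "good V \<longleftrightarrow> V \<in> C \<and> supp V \<subseteq> S \<union> B \<and> V s0 \<noteq> \<sigma> \<and> (\<forall>b\<in>B. V b = Zer \<or> V b = Y b)" for V
  have "good Y"
    using Y S by (auto simp: good_def)
  then obtain V where V: "good V" "\<And>V'. good V' \<Longrightarrow> card (supp V \<inter> B) \<le> card (supp V' \<inter> B)"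
    using ex_has_least_nat[of good Y "\<lambda>V. card (supp V \<inter> B)"] by blast
  have VC: "V \<in> C" "supp V \<subseteq> S \<union> B" "V s0 \<noteq> \<sigma>"
    using V(1) by (auto simp: good_def)
  have "\<not> supp V \<subseteq> S"
    using card_mono[of S "supp V"] S(1,2) card_supp[OF VC(1)] by auto
  then obtain b where b: "b \<in> B" "V b \<noteq> Zer"
    using VC(2) by (metis UnE subset_iff supp_iff)
  obtain W where W: "W \<in> C" "supp W = insert b S" "W s0 = \<sigma>" "W b = Y b"
    using Z[OF b(1)] by blast
  have Vb: "V b = W b"
    using V(1) b W(4) by (auto simp: good_def)
  have "V \<noteq> neg (neg W)"
    using W(3) VC(3) by auto
  moreover have "b \<in> sep V (neg W)"
    using Vb b eq_negsv_iff by auto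
  ultimately obtain V' where V': "V' \<in> C" "V' b = Zer" "\<And>f. V' f \<noteq> Zer \<Longrightarrow> V' f = V f \<or> V' f = neg W f"
    using weak_elimE[OF VC(1) neg_closed[OF W(1)]] by metis
  have sub: "V' f = Zer \<or> V' f = V f" if "f \<in> B" for f
  proof (cases "f = b")
    case False
    then have "W f = Zer"
      using W(2) that B supp_iff[of f W] by blast
    then show ?thesis using V'(3)[of f] by auto
  qed (use V' in simp)
  have "good V'"
    unfolding good_def
  proof (intro conjI ballI)
    show "supp V' \<subseteq> S \<union> B"
    proof
      fix f assume "f \<in> supp V'"
      then have "f \<in> supp V \<union> supp W"
        using V'(3)[of f] by auto
      then show "f \<in> S \<union> B"
        using VC(2) W(2) b(1) by (metis UnE UnI1 UnI2 insertE subsetD)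
    qed
    show "V' s0 \<noteq> \<sigma>"
      using V'(3)[of s0] VC(3) W(3) S(4) eq_negsv_iff[of \<sigma> \<sigma>] by auto
    show "V' f = Zer \<or> V' f = Y f" if "f \<in> B" for f
      using sub[OF that] V(1) that by (auto simp: good_def)
  qed (fact V')
  moreover have "card (supp V' \<inter> B) < card (supp V \<inter> B)"
  proof (rule psubset_card_mono)
    show "supp V' \<inter> B \<subset> supp V \<inter> B"
      using sub b V'(2) by fastforce
  qed (use B in simp)
  ultimately show False
    using V(2)[of V'] by simp
qed

subsection \<open>Planes\<close>

text \<open>A path through a corner \<open>P\<close> crosses twice the elements which \<open>P\<close> cuts off from both \<open>X\<close> and \<open>Y\<close>.
  If there is just one of them, then following it instead of crossing it saves a step.\<close>

lemma reach_corner: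
  assumes C: "X \<in> C" "P \<in> C" "Y \<in> C"
    and U: "card (supp X \<union> supp P) = Suc (Suc d)" "card (supp P \<union> supp Y) = Suc (Suc d)"
      "card (supp X \<union> supp P \<union> supp Y) = Suc (Suc (Suc d))"
    and sub: "supp X \<inter> supp Y \<subseteq> supp P" "sep X P \<subseteq> supp Y" "sep P Y \<subseteq> supp X"
    and cut: "card (sep X P \<inter> sep P Y) \<le> 1"
  shows "reach X Y (2 + card (sep X Y) + card (sep X P \<inter> sep P Y))"
proof -
  let ?D = "sep X P \<inter> sep P Y"
  have fin: "finite (supp X)" "finite (supp P)" "finite (supp Y)"
    using C finite_supp by auto
  have dich: "f \<in> sep X Y" if "f \<in> sep X P \<union> sep P Y" "f \<notin> ?D" for f
  proof -
    have "X f \<noteq> Zer" "P f \<noteq> Zer" "Y f \<noteq> Zer"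
      using that(1) sub by auto
    then show ?thesis
      using that sign_two[of "X f" "P f" "Y f"] by auto
  qed
  show ?thesis
  proof (cases "?D = {}")
    case True
    have "card (sep X P) + card (sep P Y) = card (sep X P \<union> sep P Y)"
      using True finite_sep C by (simp add: card_Un_disjoint)
    also have "\<dots> \<le> card (sep X Y)"
      using dich True finite_sep C by (intro card_mono) blast+
    finally have "Suc (card (sep X P)) + Suc (card (sep P Y)) \<le> 2 + card (sep X Y) + card ?D"
      by simp
    then show ?thesis
      using reach_trans[OF reach_line reach_line] reach_mono C U by blast
  next
    case False
    then have "card ?D = 1"
      using cut finite_sep C by (metis One_nat_def card_gt_0_iff finite_Int le_antisym Suc_leI)
    then obtain c where c: "?D = {c}"
      by (rule card_1_singletonE)
    \<comment> \<open>The path \<open>X\<close>, \<open>V\<close>, \<open>W\<close>,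
      \<open>Y\<close> leaves the corner out and runs from \<open>V\<close> to \<open>W\<close>
      inside the hyperplane of \<open>c\<close>. It has three segments instead of two, but never
      crosses \<open>c\<close>, whereas the path through \<open>P\<close> crosses \<open>c\<close>
      twice.\<close>
    obtain V where V: "V \<in> C" "supp V = supp X \<union> supp P - {c}"
      "\<And>f. X f \<noteq> Zer \<Longrightarrow> f \<notin> sep X P \<Longrightarrow> V f = X f"
      "\<And>f. P f \<noteq> Zer \<Longrightarrow> f \<notin> sep X P \<Longrightarrow> V f = P f"
      using line_elim[OF C(1,2) U(1), of c] c by (metis IntD1 insertI1)
    obtain W where W: "W \<in> C" "supp W = supp P \<union> supp Y - {c}"
      "\<And>f. P f \<noteq> Zer \<Longrightarrow> f \<notin> sep P Y \<Longrightarrow> W f = P f"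
      "\<And>f. Y f \<noteq> Zer \<Longrightarrow> f \<notin> sep P Y \<Longrightarrow> W f = Y f"
      using line_elim[OF C(2,3) U(2), of c] c by (metis IntD2 insertI1)
    have cs: "c \<in> sep X P" "c \<in> sep P Y"
      using c by auto
    have Vc: "V c = Zer" "W c = Zer"
      using V(2) W(2) supp_iff by fast+
    have 1: "f \<in> sep X P \<and> V f = P f" if "f \<in> sep X V" for f
    proof -
      have "f \<in> sep X P"
        using that V(3)[of f] by fastforce
      then show ?thesis
        using that sign_two[of "V f" "X f" "P f"] by auto
    qed
    have 2: "f \<in> sep P Y \<and> W f = P f" if "f \<in> sep W Y" for f
    proof -
      have "f \<in> sep P Y"
        using that W(4)[of f] by fastforce
      then show ?thesis
        using that sign_two[of "W f" "Y f" "P f"] by auto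
    qed
    have 3: "P f \<noteq> Zer" if "f \<in> sep V W" for f
    proof -
      have "f \<in> supp V" "f \<in> supp W"
        using that by auto
      then have "f \<in> supp P"
        using V(2) W(2) sub(1) by blast
      then show ?thesis by simp
    qed
    have 4: "f \<in> sep X P \<union> sep P Y" if "f \<in> sep V W" for f
      using 3[OF that] V(4)[of f] W(3)[of f] that by force
    have c1: "f \<noteq> c" if "f \<in> sep X V \<union> sep V W \<union> sep W Y" for f
      using that Vc by auto
    have sub': "sep X V \<union> sep V W \<union> sep W Y \<subseteq> sep X Y"
    proof
      fix f assume f: "f \<in> sep X V \<union> sep V W \<union> sep W Y"
      then have "f \<in> sep X P \<union> sep P Y"
        using 1[of f] 2[of f] 4[of f] by blast
      moreover have "f \<notin> ?D"
        unfolding c using c1[OF f] by simp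
      ultimately show "f \<in> sep X Y"
        by (rule dich)
    qed
    have d1: "sep X V \<inter> sep V W = {}"
    proof (rule equals0I)
      fix f assume f: "f \<in> sep X V \<inter> sep V W"
      then have "f \<notin> sep P Y"
        using 1[of f] c c1[of f] by blast
      then have "W f = P f"
        using W(3)[of f] f 3[of f] by blast
      then show False
        using 1[of f] f by auto
    qed
    have d2: "sep V W \<inter> sep W Y = {}"
    proof (rule equals0I)
      fix f assume f: "f \<in> sep V W \<inter> sep W Y"
      then have "f \<notin> sep X P"
        using 2[of f] c c1[of f] by blast
      then have "V f = P f"
        using V(4)[of f] f 3[of f] by blast
      then show False
        using 2[of f] f by auto
    qed
    have d3: "sep X V \<inter> sep W Y = {}"
    proof (rule equals0I)
      fix f assume f: "f \<in> sep X V \<inter> sep W Y"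
      then have "f \<in> ?D"
        using 1[of f] 2[of f] by blast
      then show False
        unfolding c using f c1[of f] by blast
    qed
    have "card (sep X V) + card (sep V W) + card (sep W Y) = card (sep X V \<union> sep V W \<union> sep W Y)"
      using d1 d2 d3 finite_sep C V(1) W(1) by (simp add: card_Un_disjoint Int_Un_distrib2)
    also have "\<dots> \<le> card (sep X Y)"
      using sub' finite_sep C by (intro card_mono) auto
    finally have le: "Suc (card (sep X V)) + Suc (card (sep V W)) + Suc (card (sep W Y))
        \<le> 2 + card (sep X Y) + card ?D"
      using c by simp
    have csupp: "c \<in> supp X" "c \<in> supp Y"
      using cs by auto
    then have UXV: "supp X \<union> supp V = supp X \<union> supp P" "supp W \<union> supp Y = supp P \<union> supp Y"
      unfolding V(2) W(2) by blast+
    have "supp V \<union> supp W = supp X \<union> supp P \<union> supp Y - {c}"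
      unfolding V(2) W(2) by blast
    then have UVW: "card (supp V \<union> supp W) = Suc (Suc d)"
      using U(3) csupp by simp
    have "reach X Y (Suc (card (sep X V)) + Suc (card (sep V W)) + Suc (card (sep W Y)))"
      using reach_trans[OF reach_trans[OF reach_line[OF C(1) V(1)] reach_line[OF V(1) W(1) UVW]]
          reach_line[OF W(1) C(3)]] U(1,2) UXV by simp
    then show ?thesis
      using le reach_mono by blast
  qed
qed

text \<open>Otherwise \<open>c\<close> has \<open>X\<close> and \<open>Y\<close> on one side and
  both corners on the other. The lines \<open>XP\<close>, \<open>XP'\<close> and \<open>YP\<close>
  then meet the hyperplane of \<open>c\<close> in three points of one line of the plane. Their signs
  at \<open>a2\<close>, \<open>b1\<close> and \<open>b2\<close> are inherited from \<open>X\<close>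
  and \<open>Y\<close> and agree pairwise, against \<open>line_triangle\<close>.\<close>

lemma corners_not_both_cut:
  assumes C: "X \<in> C" "Y \<in> C" "P \<in> C" "P' \<in> C"
    and supp: "supp X = insert a1 (insert a2 K)" "supp Y = insert b1 (insert b2 K)"
      "supp P = insert a1 (insert b1 K)" "supp P' = insert a2 (insert b2 K)"
    and dist: "distinct [a1, a2, b1, b2]" "a1 \<notin> K" "a2 \<notin> K" "b1 \<notin> K" "b2 \<notin> K"
    and eq: "P a1 = X a1" "P b1 = Y b1" "P' a2 = X a2" "P' b2 = Y b2"
    and c: "c \<in> K" "X c = Y c" "P c \<noteq> X c"
  shows "P' c = X c"
proof (rule ccontr)
  assume c': "P' c \<noteq> X c"
  have z: "W x = Zer" if "supp W = S" "x \<notin> S" for W :: "'a signvec" and x S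
    using that supp_iff by fast
  have nz: "W x \<noteq> Zer" if "supp W = S" "x \<in> S" for W :: "'a signvec" and x S
    using that supp_iff by fast
  have zs: "X b1 = Zer" "X b2 = Zer" "Y a1 = Zer" "Y a2 = Zer" "P a2 = Zer" "P b2 = Zer" "P' a1 = Zer" "P' b1 = Zer"
    using z[OF supp(1)] z[OF supp(2)] z[OF supp(3)] z[OF supp(4)] dist by auto
  have nzs: "X a1 \<noteq> Zer" "X a2 \<noteq> Zer" "Y b1 \<noteq> Zer" "Y b2 \<noteq> Zer" "X c \<noteq> Zer" "P c \<noteq> Zer" "P' c \<noteq> Zer"
    using nz[OF supp(1)] nz[OF supp(2)] nz[OF supp(3)] nz[OF supp(4)] c(1) by auto
  have fin: "finite K"
    using finite_supp[OF C(1)] supp(1) by simp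
  have cardK: "Suc (card K) = d"
    using card_supp[OF C(1)] supp(1) fin dist by simp
  have "c \<in> sep X P" "c \<in> sep X P'" "c \<in> sep Y P"
    using nzs c c' by auto
  note cs = this
  have U: "supp X \<union> supp P = insert a1 (insert a2 (insert b1 K))"
    "supp X \<union> supp P' = insert a1 (insert a2 (insert b2 K))"
    "supp Y \<union> supp P = insert a1 (insert b1 (insert b2 K))"
    unfolding supp by blast+
  have cU: "card (supp X \<union> supp P) = Suc (Suc d)" "card (supp X \<union> supp P') = Suc (Suc d)"
    "card (supp Y \<union> supp P) = Suc (Suc d)"
    unfolding U using dist fin cardK by simp_all
  obtain V where
    V: "V \<in> C" "supp V = insert a1 (insert a2 (insert b1 K)) - {c}"
      "\<And>f. X f \<noteq> Zer \<Longrightarrow> f \<notin> sep X P \<Longrightarrow> V f = X f" "\<And>f. P f \<noteq> Zer \<Longrightarrow> f \<notin> sep X P \<Longrightarrow> V f = P f"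
    using line_elim[OF C(1,3) cU(1) cs(1)] unfolding U by metis
  obtain V' where
    V': "V' \<in> C" "supp V' = insert a1 (insert a2 (insert b2 K)) - {c}"
      "\<And>f. X f \<noteq> Zer \<Longrightarrow> f \<notin> sep X P' \<Longrightarrow> V' f = X f" "\<And>f. P' f \<noteq> Zer \<Longrightarrow> f \<notin> sep X P' \<Longrightarrow> V' f = P' f"
    using line_elim[OF C(1,4) cU(2) cs(2)] unfolding U by metis
  obtain W where
    W: "W \<in> C" "supp W = insert a1 (insert b1 (insert b2 K)) - {c}"
      "\<And>f. Y f \<noteq> Zer \<Longrightarrow> f \<notin> sep Y P \<Longrightarrow> W f = Y f" "\<And>f. P f \<noteq> Zer \<Longrightarrow> f \<notin> sep Y P \<Longrightarrow> W f = P f"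
    using line_elim[OF C(2,3) cU(3) cs(3)] unfolding U by metis
  define U where "U = insert a1 (insert a2 (insert b1 (insert b2 (K - {c}))))"
  have "card U = Suc (Suc d)"
    using dist fin cardK c(1) card_gt_0_iff[of K] by (auto simp: U_def card_Diff_singleton)
  moreover have "supp V = U - {b2}" "supp V' = U - {b1}" "supp W = U - {a2}"
    unfolding V(2) V'(2) W(2) U_def using dist c(1) by auto
  moreover have "V a2 = X a2" "V' a2 = X a2" "V b1 = Y b1" "W b1 = Y b1" "V' b2 = Y b2" "W b2 = Y b2"
    using V(3)[of a2] V'(3)[of a2] V(4)[of b1] W(3)[of b1] V'(4)[of b2] W(3)[of b2] nzs zs eq by auto
  ultimately show False
    using line_triangle[OF V(1) V'(1) W(1), of U b2 b1 a2] dist by (auto simp: U_def)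
qed

text \<open>Normalise each of the four corners \<open>P a b\<close> to agree with \<open>X\<close>
  at \<open>a\<close>. By \<open>line_triangle\<close> on the line through \<open>X\<close>, exactly
  one of \<open>P a1 b\<close> and \<open>P a2 b\<close> agrees with \<open>Y\<close> at
  \<open>b\<close>; on the line through \<open>Y\<close>, the corners \<open>P a b1\<close> and
  \<open>P a b2\<close> cannot both agree with \<open>Y\<close>. So the agreeing corners for
  \<open>b1\<close> and \<open>b2\<close> are opposite.\<close>

lemma plane_corners:
  assumes C: "X \<in> C" "Y \<in> C"
    and supp: "supp X = insert a1 (insert a2 K)" "supp Y = insert b1 (insert b2 K)"
    and dist: "distinct [a1, a2, b1, b2]" "a1 \<notin> K" "a2 \<notin> K" "b1 \<notin> K" "b2 \<notin> K"
  obtains P P' b b' where "P \<in> C" "P' \<in> C" "insert b (insert b' K) = supp Y" "b \<noteq> b'"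
    "{b, b'} = {b1, b2}"
    "supp P = insert a1 (insert b K)" "supp P' = insert a2 (insert b' K)"
    "P a1 = X a1" "P b = Y b" "P' a2 = X a2" "P' b' = Y b'"
proof -
  have fin: "finite K"
    using finite_supp[OF C(1)] supp(1) by simp
  have cardK: "Suc (card K) = d"
    using card_supp[OF C(1)] supp(1) fin dist by simp
  have nz: "X a1 \<noteq> Zer" "X a2 \<noteq> Zer" "Y b1 \<noteq> Zer" "Y b2 \<noteq> Zer"
    using supp supp_iff by (metis insertI1 insertI2)+
  have "\<exists>P. P \<in> C \<and> supp P = insert a (insert b K) \<and> P a = X a"
    if "a \<in> {a1, a2}" "b \<in> {b1, b2}" for a b
  proof -
    have "insert a (insert b K) \<subseteq> supp X \<union> supp Y"
      unfolding supp using that by blast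
    then have "insert a (insert b K) \<subseteq> E"
      using supp_subset C by blast
    moreover have "card (insert a (insert b K)) = Suc d"
      using that dist fin cardK by auto
    ultimately show ?thesis
      using ex_supp_sign[of "insert a (insert b K)" a "X a"] nz that by (metis insertCI insertE singletonD)
  qed
  then obtain P where P: "\<And>a b. a \<in> {a1, a2} \<Longrightarrow> b \<in> {b1, b2} \<Longrightarrow>
      P a b \<in> C \<and> supp (P a b) = insert a (insert b K) \<and> P a b a = X a"
    by metis
  have nzP: "P a b b \<noteq> Zer" if "a \<in> {a1, a2}" "b \<in> {b1, b2}" for a b
    using P[OF that] supp_iff by (metis insertI1 insertI2)
  have 1: "P a1 b b \<noteq> P a2 b b" if b: "b \<in> {b1, b2}" for b
  proof (rule line_triangle[of X "P a1 b" "P a2 b" "insert a1 (insert a2 (insert b K))" b a2 a1])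
    show "card (insert a1 (insert a2 (insert b K))) = Suc (Suc d)"
      using b dist fin cardK by auto
    show "supp X = insert a1 (insert a2 (insert b K)) - {b}"
      "supp (P a1 b) = insert a1 (insert a2 (insert b K)) - {a2}"
      "supp (P a2 b) = insert a1 (insert a2 (insert b K)) - {a1}"
      using P[of a1 b] P[of a2 b] b dist supp(1) by auto
  qed (use b P[of a1 b] P[of a2 b] C dist in auto)
  have 2: "\<not> (P a b1 b1 = Y b1 \<and> P a b2 b2 = Y b2)" if a: "a \<in> {a1, a2}" for a
  proof
    assume eq: "P a b1 b1 = Y b1 \<and> P a b2 b2 = Y b2"
    have "P a b1 a \<noteq> P a b2 a"
    proof (rule line_triangle[of Y "P a b1" "P a b2" "insert b1 (insert b2 (insert a K))" a b2 b1])
      show "card (insert b1 (insert b2 (insert a K))) = Suc (Suc d)"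
        using a dist fin cardK by auto
      show "supp Y = insert b1 (insert b2 (insert a K)) - {a}"
        "supp (P a b1) = insert b1 (insert b2 (insert a K)) - {b2}"
        "supp (P a b2) = insert b1 (insert b2 (insert a K)) - {b1}"
        using P[of a b1] P[of a b2] a dist supp(2) by auto
    qed (use a P[of a b1] P[of a b2] C dist eq in auto)
    then show False
      using P a by auto
  qed
  have 3: "P a1 b b = Y b \<or> P a2 b b = Y b" if "b \<in> {b1, b2}" for b
  proof -
    have "P a1 b b \<noteq> Zer" "P a2 b b \<noteq> Zer" "Y b \<noteq> Zer"
      using nzP[of a1 b] nzP[of a2 b] nz that by auto
    then show ?thesis
      using sign_two[of "P a1 b b" "P a2 b b" "Y b"] 1[OF that] by metis
  qed
  show thesis
  proof (cases "P a1 b1 b1 = Y b1")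
    case True
    then have "P a2 b2 b2 = Y b2"
      using 2[of a1] 3[of b2] by blast
    then show thesis
      using True P[of a1 b1] P[of a2 b2] supp dist by (intro that[of "P a1 b1" "P a2 b2" b1 b2]) simp_all
  next
    case False
    then have t: "P a2 b1 b1 = Y b1"
      using 3[of b1] by blast
    then have "P a1 b2 b2 = Y b2"
      using 2[of a2] 3[of b2] by blast
    then show thesis
      using t P[of a1 b2] P[of a2 b1] supp dist
      by (intro that[of "P a1 b2" "P a2 b1" b2 b1]) (auto simp: insert_commute)
  qed
qed

lemma reach_plane:
  assumes C: "X \<in> C" "Y \<in> C" and two: "card (supp Y - supp X) = 2" and d: "d \<le> 4"
  shows "reach X Y (2 + card (sep X Y) + (d - 1 - card (sep X Y)) div 2)"
proof -
  define K where "K = supp X \<inter> supp Y"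
  have fin: "finite (supp X)" "finite (supp Y)" "finite K"
    using C finite_supp by (auto simp: K_def)
  have "card (supp Y) = card K + card (supp Y - supp X)"
    using fin unfolding K_def by (metis Int_commute card_Int_Diff)
  then have cardK: "Suc (card K) = d"
    using card_supp[OF C(2)] two by simp
  have "card (supp X) = card K + card (supp X - supp Y)"
    using fin unfolding K_def by (metis card_Int_Diff)
  then have "card (supp X - supp Y) = 2"
    using card_supp[OF C(1)] cardK by simp
  then obtain a1 a2 where a: "supp X - supp Y = {a1, a2}" "a1 \<noteq> a2"
    by (auto simp: card_2_iff)
  obtain b1 b2 where b: "supp Y - supp X = {b1, b2}" "b1 \<noteq> b2"
    using two by (auto simp: card_2_iff)
  have supp: "supp X = insert a1 (insert a2 K)" "supp Y = insert b1 (insert b2 K)"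
    using a(1) b(1) unfolding K_def by blast+
  have "a1 \<in> supp X - supp Y" "a2 \<in> supp X - supp Y" "b1 \<in> supp Y - supp X" "b2 \<in> supp Y - supp X"
    unfolding a b by blast+
  then have dist: "distinct [a1, a2, b1, b2]" "a1 \<notin> K" "a2 \<notin> K" "b1 \<notin> K" "b2 \<notin> K"
    using a(2) b(2) unfolding K_def by auto
  obtain P P' b b' where P: "P \<in> C" "P' \<in> C" "insert b (insert b' K) = supp Y" "b \<noteq> b'"
    "{b, b'} = {b1, b2}"
    "supp P = insert a1 (insert b K)" "supp P' = insert a2 (insert b' K)"
    "P a1 = X a1" "P b = Y b" "P' a2 = X a2" "P' b' = Y b'"
    using plane_corners[OF C supp dist] by metis
  have dist': "distinct [a1, a2, b, b']" "a1 \<notin> K" "a2 \<notin> K" "b \<notin> K" "b' \<notin> K"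
    using dist P(4,5) by (auto simp: doubleton_eq_iff)
  have sepK: "sep X Y \<subseteq> K"
    by (auto simp: K_def)
  have side: "sep X Q \<subseteq> supp Y \<and> sep Q Y \<subseteq> supp X \<and> sep X Q \<inter> sep Q Y \<subseteq> K - sep X Y"
    if Q: "supp Q = insert u (insert v K)" "Q u = X u" "Q v = Y v" "u \<notin> supp Y" "v \<notin> supp X" for Q u v
  proof -
    have "f \<in> K" if "f \<in> sep X Q \<union> sep Q Y" for f
    proof -
      have "f \<in> supp Q" "f \<noteq> u" "f \<noteq> v"
        using that Q(2-5) by auto
      then show "f \<in> K"
        using Q(1) by blast
    qed
    moreover have "f \<notin> sep X Y" if "f \<in> sep X Q" "f \<in> sep Q Y" for f
      using that sign_two[of "X f" "Q f" "Y f"] unfolding sep_iff by metis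
    ultimately show ?thesis
      unfolding K_def by blast
  qed
  have nm: "a1 \<notin> supp Y" "a2 \<notin> supp Y" "b \<notin> supp X" "b' \<notin> supp X"
    unfolding supp using dist dist' by auto
  note sP = side[OF P(6,8,9) nm(1,3)] and sP' = side[OF P(7,10,11) nm(2,4)]
  define D where "D = sep X P \<inter> sep P Y"
  define D' where "D' = sep X P' \<inter> sep P' Y"
  have "D \<inter> D' = {}"
  proof (rule equals0I)
    fix c assume c: "c \<in> D \<inter> D'"
    then have "c \<in> K - sep X Y"
      using sP unfolding D_def by blast
    then have "c \<in> K" "X c = Y c"
      by (auto simp: K_def)
    moreover have "P c \<noteq> X c" "P' c \<noteq> X c"
      using c by (auto simp: D_def D'_def)
    ultimately show False
      using corners_not_both_cut[OF C P(1,2) supp(1) P(3)[symmetric] P(6,7) dist' P(8-11)] by blast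
  qed
  moreover have sub: "D \<subseteq> K - sep X Y" "D' \<subseteq> K - sep X Y"
    using sP sP' unfolding D_def D'_def by blast+
  ultimately have "card D + card D' \<le> card (K - sep X Y)"
    using fin by (metis card_Un_disjoint card_mono finite_Diff finite_subset le_sup_iff)
  moreover have "card (K - sep X Y) = d - 1 - card (sep X Y)"
    using sepK fin cardK by (simp add: card_Diff_subset finite_subset)
  ultimately have le: "card D + card D' \<le> d - 1 - card (sep X Y)"
    by simp
  have corner: "reach X Y (2 + card (sep X Y) + (d - 1 - card (sep X Y)) div 2)"
    if Q: "Q \<in> C" "supp Q = insert u (insert v K)" "Q u = X u" "Q v = Y v"
      and u: "u \<in> {a1, a2}" "v \<in> {b1, b2}"
      and le: "card (sep X Q \<inter> sep Q Y) \<le> (d - 1 - card (sep X Y)) div 2" for Q u v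
  proof -
    have un: "supp X \<union> supp Q = insert v (supp X)" "supp Q \<union> supp Y = insert u (supp Y)"
        "supp X \<union> supp Q \<union> supp Y = insert a1 (insert a2 (supp Y))"
      unfolding Q(2) supp using u by blast+
    have uv: "v \<notin> supp X" "u \<notin> supp Y" "a1 \<notin> supp Y" "a2 \<notin> supp Y"
      unfolding supp using u dist by auto
    then have "card (supp X \<union> supp Q) = Suc (Suc d)" "card (supp Q \<union> supp Y) = Suc (Suc d)"
      unfolding un using fin card_supp C by simp_all
    moreover have "card (supp X \<union> supp Q \<union> supp Y) = Suc (Suc (Suc d))"
      unfolding un(3) using uv a(2) fin card_supp C by simp
    moreover have "supp X \<inter> supp Y \<subseteq> supp Q"
      unfolding Q(2) K_def by blast
    moreover have "card (sep X Q \<inter> sep Q Y) \<le> 1"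
      using le d by linarith
    ultimately have "reach X Y (2 + card (sep X Y) + card (sep X Q \<inter> sep Q Y))"
      using reach_corner[OF C(1) Q(1) C(2)] side[OF Q(2-4) uv(2,1)] by blast
    then show ?thesis
      by (rule reach_mono) (use le in simp)
  qed
  have bb: "b \<in> {b1, b2}" "b' \<in> {b1, b2}"
    using P(5) by blast+
  show ?thesis
  proof (cases "card D \<le> card D'")
    case True
    then have "card D \<le> (d - 1 - card (sep X Y)) div 2"
      using le by linarith
    then show ?thesis
      using corner[OF P(1,6,8,9)] bb unfolding D_def by blast
  next
    case False
    then have "card D' \<le> (d - 1 - card (sep X Y)) div 2"
      using le by linarith
    then show ?thesis
      using corner[OF P(2,7,10,11)] bb unfolding D'_def by blast
  qed
qed

subsection \<open>Supports differing in three to five elements\<close>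

lemma card_supp_Diff:
  assumes "X \<in> C" "Y \<in> C"
  shows "card (supp X - supp Y) = card (supp Y - supp X)"
    and "card (supp X \<inter> supp Y) + card (supp Y - supp X) = Suc d"
    and "card (supp X \<union> supp Y) = Suc d + card (supp Y - supp X)"
proof -
  have fin: "finite (supp X)" "finite (supp Y)"
    using assms finite_supp by auto
  have 1: "card (supp X) = card (supp X \<inter> supp Y) + card (supp X - supp Y)"
    using fin by (metis card_Int_Diff)
  have 2: "card (supp Y) = card (supp X \<inter> supp Y) + card (supp Y - supp X)"
    using fin by (metis card_Int_Diff Int_commute)
  have 3: "card (supp X) + card (supp Y) = card (supp X \<union> supp Y) + card (supp X \<inter> supp Y)"
    using fin by (rule card_Un_Int)
  show "card (supp X - supp Y) = card (supp Y - supp X)"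
    "card (supp X \<inter> supp Y) + card (supp Y - supp X) = Suc d"
    "card (supp X \<union> supp Y) = Suc d + card (supp Y - supp X)"
    using 1 2 3 card_supp[OF assms(1)] card_supp[OF assms(2)] by simp_all
qed

text \<open>The case \<open>A = supp X\<close> of \<open>pivot\<close>, an edge at \<open>X\<close>:
  as in the simplex method, \<open>b\<close> enters the support with sign \<open>s\<close> and
  \<open>a\<close> leaves it.\<close>

definition is_pivot :: "'a signvec \<Rightarrow> 'a \<Rightarrow> sign \<Rightarrow> 'a signvec \<Rightarrow> 'a \<Rightarrow> bool" where
  "is_pivot X b s Z a \<longleftrightarrow> Z \<in> C \<and> a \<in> supp X \<and> supp Z = insert b (supp X) - {a} \<and> Z b = s \<and>
     (\<forall>f\<in>supp X. f \<noteq> a \<longrightarrow> Z f = X f)"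

lemma is_pivotD:
  assumes "is_pivot X b s Z a"
  shows "Z \<in> C" "a \<in> supp X" "supp Z = insert b (supp X) - {a}" "Z b = s"
    and "\<And>f. f \<in> supp X \<Longrightarrow> f \<noteq> a \<Longrightarrow> Z f = X f"
  using assms unfolding is_pivot_def by blast+

lemma ex_pivot:
  assumes "X \<in> C" "b \<in> E" "b \<notin> supp X" "s \<noteq> Zer"
  obtains Z a where "is_pivot X b s Z a"
proof -
  have "supp X \<noteq> {}"
    using card_supp[OF assms(1)] by auto
  then obtain Z a where "Z \<in> C" "a \<in> supp X" "supp Z = insert b (supp X) - {a}" "Z b = s"
    "\<And>f. f \<in> supp X \<Longrightarrow> f \<noteq> a \<Longrightarrow> Z f = X f"
    using pivot[OF assms, of "supp X"] by blast
  then have "is_pivot X b s Z a"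
    unfolding is_pivot_def by blast
  then show thesis by (rule that)
qed

text \<open>If the leaving elements differed, \<open>X\<close>, \<open>Z\<close> and
  \<open>Z'\<close> would lie on one line and agree pairwise, against
  \<open>line_triangle\<close>.\<close>

lemma is_pivot_unique:
  assumes X: "X \<in> C" "b \<notin> supp X" and Z: "is_pivot X b s Z a" "is_pivot X b s Z' a'"
  shows "a = a'"
proof (rule ccontr)
  assume ne: "a \<noteq> a'"
  have p: "Z \<in> C" "a \<in> supp X" "supp Z = insert b (supp X) - {a}" "Z b = s" "Z a' = X a'"
    "Z' \<in> C" "a' \<in> supp X" "supp Z' = insert b (supp X) - {a'}" "Z' b = s" "Z' a = X a"
    using Z ne unfolding is_pivot_def by blast+
  have "Z b \<noteq> Z' b"
  proof (rule line_triangle[OF X(1) p(1,6) _ _ _ _ _ _ ne _ p(3,8)])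
    show "card (insert b (supp X)) = Suc (Suc d)"
      using X finite_supp card_supp by simp
    show "supp X = insert b (supp X) - {b}"
      using X(2) by blast
    show "b \<noteq> a" "b \<noteq> a'"
      using X(2) p(2,7) by blast+
  qed (use p in simp_all)
  then show False
    using p by simp
qed

text \<open>With a common leaving element, \<open>Z\<close> and \<open>Z'\<close> would have the
  same support and agree with \<open>X\<close> on the rest of \<open>supp X\<close>, which is
  nonempty because \<open>0 < d\<close>. So they would be equal, also at \<open>b\<close>.\<close>

lemma is_pivot_opposite:
  assumes X: "X \<in> C" "b \<notin> supp X" and Z: "is_pivot X b s Z a" "is_pivot X b t Z' a'"
    and "s \<noteq> t" "0 < d"
  shows "a \<noteq> a'"
proof
  assume eq: "a = a'"
  have p: "Z \<in> C" "a \<in> supp X" "supp Z = insert b (supp X) - {a}" "Z b = s"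
    "Z' \<in> C" "supp Z' = insert b (supp X) - {a}" "Z' b = t"
    using Z eq unfolding is_pivot_def by blast+
  have "card (supp X - {a}) = d"
    using p(2) card_supp[OF X(1)] finite_supp[OF X(1)] by (simp del: supp_iff)
  then obtain f where f: "f \<in> supp X - {a}"
    using \<open>0 < d\<close> by (metis all_not_in_conv card.empty less_irrefl)
  then have "Z f = X f" "Z' f = X f"
    using Z eq unfolding is_pivot_def by blast+
  then have "Z = Z'"
    using eq_if_agree[OF p(1,5), of f] p(3,6) f by simp
  then show False
    using p \<open>s \<noteq> t\<close> by simp
qed

lemma reach_pivot:
  assumes X: "X \<in> C" "b \<notin> supp X" and Z: "is_pivot X b s Z a"
  shows "reach X Z 1"
proof (rule reach_adj)
  show "Z \<in> C"
    using Z by (simp add: is_pivot_def)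
  have "supp X \<union> supp Z = insert b (supp X)"
    using Z unfolding is_pivot_def by blast
  then show "card (supp X \<union> supp Z) = Suc (Suc d)"
    using X finite_supp card_supp by simp
  show "sep X Z = {}"
  proof (rule equals0I)
    fix f assume f: "f \<in> sep X Z"
    then have "f \<in> supp X" "f \<in> supp Z"
      by auto
    then have "Z f = X f"
      using Z unfolding is_pivot_def by blast
    then show False
      using f by simp
  qed
qed (fact X)

text \<open>Choose a line through \<open>X\<close>, which exists since the rank is at least two, and
  walk along it to \<open>neg X\<close>. The first step crosses nothing, and the neighbour
  \<open>P\<close> shares only \<open>d\<close> elements of the support with
  \<open>neg X\<close>.\<close>

lemma reach_neg:
  assumes X: "X \<in> C"
  shows "reach X (neg X) (Suc (Suc d))"
proof -
  obtain b where b: "b \<in> E" "b \<notin> supp X"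
    using card_mono[OF finite_supp[OF X], of E] card_E rank_ge_2 card_supp[OF X] by fastforce
  obtain P a where P: "is_pivot X b Pos P a"
    using ex_pivot[OF X b] by blast
  then have p: "P \<in> C" "a \<in> supp X" "supp P = insert b (supp X) - {a}"
    "\<And>f. f \<in> supp X \<Longrightarrow> f \<noteq> a \<Longrightarrow> P f = X f"
    unfolding is_pivot_def by blast+
  have "supp P \<union> supp (neg X) = insert b (supp X)"
    using p(2) unfolding p(3) supp_neg by blast
  then have "card (supp P \<union> supp (neg X)) = Suc (Suc d)"
    using X b finite_supp card_supp by simp
  then have "reach P (neg X) (Suc (card (sep P (neg X))))"
    using reach_line p(1) neg_closed[OF X] by blast
  then have r: "reach X (neg X) (1 + Suc (card (sep P (neg X))))"
    using reach_trans reach_pivot[OF X b(2) P] by blast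
  have "sep P (neg X) \<subseteq> supp X - {a}"
  proof
    fix f assume f: "f \<in> sep P (neg X)"
    then have "f \<in> supp P" "f \<in> supp X"
      by auto
    then show "f \<in> supp X - {a}"
      unfolding p(3) by blast
  qed
  then have "card (sep P (neg X)) \<le> d"
    using card_mono[of "supp X - {a}" "sep P (neg X)"] p(2) finite_supp[OF X] card_supp[OF X]
    by (simp del: supp_iff)
  then show ?thesis
    using reach_mono[OF r] by simp
qed

text \<open>Leave \<open>X\<close> along a line in one of its two directions up to the first element of
  \<open>supp X - supp Y\<close>. The elements crossed before are common to both supports, and no element is
  crossed in both directions.\<close>

lemma reach_3:
  assumes C: "X \<in> C" "Y \<in> C" and k: "card (supp Y - supp X) = 3" and d: "d \<le> 4"
  shows "reach X Y (Suc (Suc d))"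
proof -
  define A where "A = supp X - supp Y"
  define K where "K = supp X \<inter> supp Y"
  have fin: "finite (supp X)" "finite (supp Y)" "finite A" "finite K"
    using C finite_supp by (auto simp: A_def K_def)
  have cA: "card A = 3"
    using card_supp_Diff(1)[OF C] k by (simp add: A_def)
  have cK: "card K + 3 = Suc d"
    using card_supp_Diff(2)[OF C] k by (simp add: K_def)
  obtain b where b: "b \<in> supp Y - supp X"
    using k by (metis all_not_in_conv card.empty zero_neq_numeral)
  then have bE: "b \<in> E" "b \<notin> supp X"
    using supp_subset[OF C(2)] by blast+
  have Yb: "Y b \<noteq> Zer"
    using b by simp
  have A: "A \<subseteq> supp X"
    unfolding A_def by blast
  have "A \<noteq> {}"
    using cA by fastforce
  note A = A this
  obtain P a where P: "P \<in> C" "a \<in> A" "supp P = insert b (supp X) - {a}" "P b = Y b"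
    "\<And>f. f \<in> A \<Longrightarrow> f \<noteq> a \<Longrightarrow> P f = X f"
    using pivot[OF C(1) bE Yb A] by metis
  obtain P' a' where P': "P' \<in> C" "a' \<in> A" "supp P' = insert b (supp X) - {a'}" "P' b = negsv (Y b)"
    "\<And>f. f \<in> A \<Longrightarrow> f \<noteq> a' \<Longrightarrow> P' f = X f"
    using pivot[OF C(1) bE _ A, of "negsv (Y b)"] Yb by (metis negsv_simps(1))
  have long: "reach X Y (Suc (card (sep X Q)) + (2 + card (sep Q Y) + (d - 1 - card (sep Q Y)) div 2))"
      "sep X Q \<subseteq> K" "sep Q Y \<subseteq> insert b K"
    if Q: "Q \<in> C" "u \<in> A" "supp Q = insert b (supp X) - {u}" "\<And>f. f \<in> A \<Longrightarrow> f \<noteq> u \<Longrightarrow> Q f = X f"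
    for Q u
  proof -
    have "supp X \<union> supp Q = insert b (supp X)"
      using A Q(2) unfolding Q(3) by blast
    then have "reach X Q (Suc (card (sep X Q)))"
      using reach_line[OF C(1) Q(1)] bE fin card_supp[OF C(1)] by simp
    moreover have "supp Y - supp Q = supp Y - supp X - {b}"
      using b Q(2) unfolding Q(3) A_def by blast
    then have "card (supp Y - supp Q) = 2"
      using b k fin by (simp del: supp_iff)
    ultimately show "reach X Y (Suc (card (sep X Q)) + (2 + card (sep Q Y) + (d - 1 - card (sep Q Y)) div 2))"
      using reach_trans reach_plane[OF Q(1) C(2) _ d] by blast
    show "sep X Q \<subseteq> K"
    proof
      fix f assume f: "f \<in> sep X Q"
      then have "f \<in> supp X" "f \<in> supp Q" "Q f \<noteq> X f"
        by auto
      then have "f \<notin> A"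
        using Q(3,4) by blast
      then show "f \<in> K"
        using \<open>f \<in> supp X\<close> unfolding A_def K_def by blast
    qed
    show "sep Q Y \<subseteq> insert b K"
    proof
      fix f assume f: "f \<in> sep Q Y"
      then have "f \<in> supp Y" "f \<in> supp Q"
        by auto
      then show "f \<in> insert b K"
        unfolding Q(3) K_def by blast
    qed
  qed
  note longP = long[OF P(1,2,3,5), simplified] and longP' = long[OF P'(1,2,3,5), simplified]
  have "sep P Y \<subseteq> K"
    using longP(3) P(4) by fastforce
  then have sPY: "card (sep P Y) \<le> card K"
    using fin card_mono by blast
  show ?thesis
  \<comment> \<open>Here \<open>K\<close> has \<open>d - 2\<close> elements. One element crossed on
    the way to \<open>P\<close> is affordable, because \<open>b\<close> has its sign in
    \<open>Y\<close> already and \<open>P\<close> is separated from \<open>Y\<close> by at most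
    \<open>d - 2\<close> elements. If two are crossed, then \<open>d = 4\<close> and they exhaust
    \<open>K\<close>; the other direction then crosses nothing, which pays for \<open>b\<close>
    having the wrong sign.\<close>
  proof (cases "card (sep X P) \<le> 1")
    case True
    show ?thesis
      by (rule reach_mono[OF longP(1)]) (use True sPY cK d in linarith)
  next
    case False
    have "sep X P = K"
      by (rule card_seteq[OF fin(4) longP(2)]) (use False cK d in linarith)
    obtain e where e: "e \<in> A" "e \<noteq> a"
    proof -
      have "card (A - {a}) = 2"
        using cA P(2) fin by simp
      then have "A - {a} \<noteq> {}"
        by fastforce
      then show thesis
        using that by blast
    qed
    have "a \<noteq> a'"
    proof
      assume "a = a'"
      then have "P = P'"
        using eq_if_agree[OF P(1) P'(1), of e] P(3,5) P'(3,5) e A by (auto simp: subset_iff)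
      then show False
        using P(4) P'(4) Yb eq_negsv_iff by metis
    qed
    \<comment> \<open>\<open>X\<close> arises from \<open>P\<close> and \<open>P'\<close> by
      eliminating \<open>b\<close>, so it keeps every sign on which the two agree.\<close>
    have "sep X P' = {}"
    proof (rule equals0I)
      fix c assume c: "c \<in> sep X P'"
      then have cK: "c \<in> K"
        using longP' by blast
      then have c2: "c \<in> sep X P"
        using \<open>sep X P = K\<close> by blast
      have same: "P c = P' c" "P c \<noteq> X c"
        using c c2 sign_two[of "P c" "X c" "P' c"] by auto
      have un: "supp P \<union> supp P' = insert b (supp X)"
        using \<open>a \<noteq> a'\<close> P(2) P'(2) A unfolding P(3) P'(3) by blast
      have "card (supp P \<union> supp P') = Suc (Suc d)"
        unfolding un using bE fin card_supp[OF C(1)] by simp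
      moreover have "b \<in> sep P P'"
        using P(4) P'(4) Yb eq_negsv_iff by (metis negsv_simps(1) sep_iff)
      ultimately obtain V where V: "V \<in> C" "supp V = insert b (supp X) - {b}"
        "\<And>f. P f \<noteq> Zer \<Longrightarrow> f \<notin> sep P P' \<Longrightarrow> V f = P f"
        "\<And>f. P' f \<noteq> Zer \<Longrightarrow> f \<notin> sep P P' \<Longrightarrow> V f = P' f"
        using line_elim[OF P(1) P'(1)] un by metis
      have "P a = Zer" "P' a = X a" "X a \<noteq> Zer"
        using P(2,3) P'(5)[of a] \<open>a \<noteq> a'\<close> A supp_iff[of a P] by auto
      then have "V a = X a"
        using V(4)[of a] by auto
      then have "V = X"
        using eq_if_agree[OF V(1) C(1), of a] V(2) bE \<open>X a \<noteq> Zer\<close> by simp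
      moreover have "V c = P c"
        using V(3)[of c] same c c2 by auto
      ultimately show False
        using same by simp
    qed
    moreover have "card (sep P' Y) \<le> Suc (card K)"
      using card_mono[OF _ longP'(3)] fin by (simp add: card_insert_if split: if_splits)
    ultimately show ?thesis
      by (intro reach_mono[OF longP'(1)]) (use cK d in simp)
  qed
qed

section \<open>Supports differing in four elements\<close>

text \<open>One pivot at each end reduces to a plane, which may cost \<open>d\<close> steps; this
  allows \<open>d - 2\<close> elements separating \<open>X1\<close> from \<open>Y1\<close>. One of
  them is reserved for \<open>a\<close>, whose sign \<open>t\<close> in \<open>Y1\<close> is
  arbitrary, and the last hypothesis bounds the others, including \<open>b\<close> if it has the
  wrong sign.\<close>

lemma reach_4_pivots:
  assumes C: "X \<in> C" "Y \<in> C" and k: "card (supp Y - supp X) = 4" and d: "d \<le> 4"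
    and X1: "is_pivot X b s X1 a1" "a1 \<notin> supp Y" "b \<in> supp Y - supp X"
    and Y1: "is_pivot Y a t Y1 b1" "b1 \<notin> supp X" "a \<in> supp X - supp Y"
    and ne: "a \<noteq> a1" "b \<noteq> b1"
    and s: "card (sep X Y) + (if s = Y b then 0 else 1) \<le> d - 3"
  shows "reach X Y (Suc (Suc d))"
proof -
  note x = is_pivotD[OF X1(1)] and y = is_pivotD[OF Y1(1)]
  have fin: "finite (supp X)" "finite (supp Y)" "finite (sep X Y)"
    using C finite_supp finite_sep by auto
  have "supp Y1 - supp X1 = supp Y - supp X - {b, b1}"
    using X1(2,3) Y1(2,3) ne x(2) unfolding x(3) y(3) by blast
  moreover have "{b, b1} \<subseteq> supp Y - supp X"
    using X1(3) Y1(2) y(2) by blast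
  ultimately have "card (supp Y1 - supp X1) = 2"
    using k ne fin by (simp add: card_Diff_subset)
  note plane = reach_plane[OF x(1) y(1) this d]
  define S where "S = (if s = Y b then sep X Y else insert b (sep X Y))"
  have "finite S" "card S \<le> d - 3"
    using s fin by (auto simp: S_def card_insert_if split: if_splits)
  have "sep X1 Y1 \<subseteq> insert a S"
  proof
    fix f assume f: "f \<in> sep X1 Y1"
    then have ff: "f \<in> supp X1" "f \<in> supp Y1" "X1 f \<noteq> Y1 f" "X1 f \<noteq> Zer" "Y1 f \<noteq> Zer"
      by auto
    show "f \<in> insert a S"
    proof (cases "f = a \<or> f = b")
      case True
      moreover have "Y1 b = Y b"
        using y(5)[of b] X1(3) ne by blast
      ultimately show ?thesis
        using ff(3) x(4) by (auto simp: S_def)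
    next
      case False
      then have "f \<in> supp X" "f \<in> supp Y" "f \<noteq> a1" "f \<noteq> b1"
        using ff(1,2) unfolding x(3) y(3) by blast+
      then have "f \<in> sep X Y"
        using ff x(5)[of f] y(5)[of f] by simp
      then show ?thesis
        by (simp add: S_def)
    qed
  qed
  then have "card (sep X1 Y1) \<le> Suc (card S)"
    using card_mono[of "insert a S" "sep X1 Y1"] \<open>finite S\<close> by (simp add: card_insert_if split: if_splits)
  then have le: "card (sep X1 Y1) \<le> Suc (d - 3)"
    using \<open>card S \<le> d - 3\<close> by linarith
  have "card (supp Y) \<ge> 4"
    using k card_mono[OF fin(2), of "supp Y - supp X"] by simp
  then have d3: "3 \<le> d"
    using card_supp[OF C(2)] by simp
  have "reach X X1 1" "reach Y1 Y 1"
    using reach_pivot[OF C(1) _ X1(1)] reach_sym[OF reach_pivot[OF C(2) _ Y1(1)]] X1(3) Y1(3) by blast+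
  from reach_trans[OF reach_trans[OF this(1) plane] this(2)] show ?thesis
    by (rule reach_mono) (use le d d3 in linarith)
qed

text \<open>Take \<open>a\<close> in \<open>supp X - supp Y\<close> different from \<open>a1\<close>
  and \<open>a2\<close>. The two pivots of \<open>Y\<close> at \<open>a\<close> have different
  leaving elements and the supports share at most one element, so one of them leaves at some
  \<open>w\<close> outside \<open>supp X\<close>. As \<open>w\<close> differs from \<open>b\<close>
  or from \<open>b'\<close>, one of the two pivots of \<open>X\<close> fits.\<close>

lemma reach_4_two_pivots:
  assumes C: "X \<in> C" "Y \<in> C" and k: "card (supp Y - supp X) = 4" and d: "d \<le> 4"
    and X1: "is_pivot X b s X1 a1" "a1 \<notin> supp Y" "b \<in> supp Y - supp X"
      "card (sep X Y) + (if s = Y b then 0 else 1) \<le> d - 3"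
    and X2: "is_pivot X b' s' X2 a2" "a2 \<notin> supp Y" "b' \<in> supp Y - supp X"
      "card (sep X Y) + (if s' = Y b' then 0 else 1) \<le> d - 3"
    and ne: "b \<noteq> b'"
  shows "reach X Y (Suc (Suc d))"
proof -
  have fin: "finite (supp X)" "finite (supp Y)"
    using C finite_supp by auto
  have "card (supp X - supp Y) = 4"
    using card_supp_Diff(1)[OF C] k by simp
  moreover have "card {a1, a2} \<le> 2"
    by (simp add: card_insert_if)
  ultimately have "\<not> supp X - supp Y \<subseteq> {a1, a2}"
    using card_mono[of "{a1, a2}" "supp X - supp Y"] by auto
  then obtain a where a: "a \<in> supp X - supp Y" "a \<noteq> a1" "a \<noteq> a2"
    by blast
  have aE: "a \<in> E" "a \<notin> supp Y"
    using a(1) supp_subset[OF C(1)] by blast+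
  obtain V \<beta> where V: "is_pivot Y a Pos V \<beta>"
    using ex_pivot[OF C(2) aE] by blast
  obtain V' \<beta>' where V': "is_pivot Y a Neg V' \<beta>'"
    using ex_pivot[OF C(2) aE] by blast
  have K: "card (supp X \<inter> supp Y) + 4 = Suc d"
    using card_supp_Diff(2)[OF C] k by simp
  then have "\<beta> \<noteq> \<beta>'"
    using is_pivot_opposite[OF C(2) aE(2) V V'] by auto
  have "\<not> {\<beta>, \<beta>'} \<subseteq> supp X \<inter> supp Y"
    using card_mono[of "supp X \<inter> supp Y" "{\<beta>, \<beta>'}"] fin K d \<open>\<beta> \<noteq> \<beta>'\<close> by auto
  moreover have "\<beta> \<in> supp Y" "\<beta>' \<in> supp Y"
    using V V' by (auto simp: is_pivot_def)
  ultimately obtain W w t where "is_pivot Y a t W w" "w \<notin> supp X"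
    using V V' by blast
  then show ?thesis
    using reach_4_pivots[OF C k d X1(1-3)] reach_4_pivots[OF C k d X2(1-3)] a X1(4) X2(4) ne by blast
qed

text \<open>A pivot of \<open>X\<close> towards \<open>Y\<close> is bad if its leaving element is
  common to both supports. Then \<open>d = 4\<close> and there is just one common element, so the
  pivot in the opposite direction is good; the wrong sign at \<open>b\<close> is affordable because
  nothing else separates.\<close>

lemma reach_4_same_tope:
  assumes C: "X \<in> C" "Y \<in> C" and k: "card (supp Y - supp X) = 4" and d: "d \<le> 4"
    and sep: "sep X Y = {}"
  shows "reach X Y (Suc (Suc d))"
proof -
  have K: "card (supp X \<inter> supp Y) + 4 = Suc d"
    using card_supp_Diff(2)[OF C] k by simp
  have *: "\<exists>s Z a. is_pivot X b s Z a \<and> a \<notin> supp Y \<and> (if s = Y b then 0 else 1) \<le> d - 3"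
    if b: "b \<in> supp Y - supp X" for b
  proof -
    have bE: "b \<in> E" "b \<notin> supp X" and Yb: "Y b \<noteq> Zer"
      using b supp_subset[OF C(2)] by auto
    obtain V \<beta> where V: "is_pivot X b (Y b) V \<beta>"
      using ex_pivot[OF C(1) bE Yb] by blast
    show ?thesis
    proof (cases "\<beta> \<in> supp Y")
      case True
      obtain V' \<beta>' where V': "is_pivot X b (negsv (Y b)) V' \<beta>'"
        using ex_pivot[OF C(1) bE] Yb by (metis negsv_simps(1))
      have "\<beta> \<noteq> \<beta>'"
        using is_pivot_opposite[OF C(1) bE(2) V V'] K Yb eq_negsv_iff by force
      have \<beta>: "\<beta> \<in> supp X \<inter> supp Y"
        using True is_pivotD(2)[OF V] by blast
      have fin: "finite (supp X \<inter> supp Y)"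
        using C finite_supp by blast
      have "\<not> {\<beta>, \<beta>'} \<subseteq> supp X \<inter> supp Y"
        using card_mono[OF fin, of "{\<beta>, \<beta>'}"] K d \<open>\<beta> \<noteq> \<beta>'\<close> by auto
      then have "\<beta>' \<notin> supp Y"
        using \<beta> is_pivotD(2)[OF V'] by blast
      moreover have "card (supp X \<inter> supp Y) \<noteq> 0"
        using \<beta> fin by (metis card_0_eq empty_iff)
      ultimately show ?thesis
        using V' K by (intro exI[of _ "negsv (Y b)"] exI[of _ V'] exI[of _ \<beta>']) auto
    next
      case False
      then show ?thesis
        using V by (intro exI[of _ "Y b"] exI[of _ V] exI[of _ \<beta>]) auto
    qed
  qed
  obtain b where b: "b \<in> supp Y - supp X"
    using k by (metis all_not_in_conv card.empty zero_neq_numeral)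
  have "\<not> supp Y - supp X \<subseteq> {b}"
    using card_mono[of "{b}" "supp Y - supp X"] k by auto
  then obtain b' where b': "b' \<in> supp Y - supp X" "b' \<noteq> b"
    by blast
  from *[OF b] *[OF b'(1)] obtain s Z a s' Z' a' where
    "is_pivot X b s Z a" "a \<notin> supp Y" "(if s = Y b then 0 else 1) \<le> d - 3"
    "is_pivot X b' s' Z' a'" "a' \<notin> supp Y" "(if s' = Y b' then 0 else 1) \<le> d - 3"
    by blast
  then show ?thesis
    using reach_4_two_pivots[OF C k d, of b s Z a b' s' Z' a'] b b' sep by auto
qed

text \<open>The path crosses over inside the hyperplane of \<open>c\<close>, the only element separating \<open>X\<close> from \<open>Y\<close>.\<close>

lemma reach_4_wall:
  assumes C: "X \<in> C" "Y \<in> C" and k: "card (supp Y - supp X) = 4" and d: "d = 4"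
    and c: "supp X \<inter> supp Y = {c}"
    and b: "is_pivot X b (Y b) X' c" "b \<in> supp Y - supp X"
    and a: "is_pivot Y a1 (X a1) Y1 c" "is_pivot Y a2 (X a2) Y2 c" "a1 \<noteq> a2"
      "a1 \<in> supp X - supp Y" "a2 \<in> supp X - supp Y"
  shows "reach X Y (Suc (Suc d))"
proof -
  define A where "A = supp X - supp Y"
  define B where "B = supp Y - supp X"
  have fin: "finite A" "finite B"
    using C finite_supp by (auto simp: A_def B_def)
  have cA: "card A = 4"
    using card_supp_Diff(1)[OF C] k by (simp add: A_def)
  have X: "supp X = insert c A" and Y: "supp Y = insert c B" and cAB: "c \<notin> A" "c \<notin> B" "A \<inter> B = {}"
    using c unfolding A_def B_def by blast+
  \<comment> \<open>Otherwise these pivots are the edges at one vertex of a simplex inside the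
    hyperplane of \<open>c\<close>, all ending in the same facet. But \<open>Y1\<close>, in the same
    hyperplane, has the signs of \<open>Y\<close> on \<open>B\<close> and vanishes at
    \<open>a2\<close>.\<close>
  have nc: "\<exists>b'\<in>B. \<not> (\<exists>Z. is_pivot X b' (Y b') Z c)"
  proof (rule ccontr)
    assume "\<not> ?thesis"
    then have all: "\<exists>Z. is_pivot X b' (Y b') Z c" if "b' \<in> B" for b'
      using that by blast
    note y = is_pivotD[OF a(1)]
    have sy: "supp Y1 = insert a1 B"
      using a(4) cAB(2) unfolding y(3) Y A_def by blast
    show False
    proof (rule simplex[of A a2 "X a2" B Y1])
      show "card A = d" "finite A" "finite B" "B \<inter> A = {}" "Y1 \<in> C"
        using cA d fin a(5) cAB(3) y(1) by (auto simp: A_def)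
      show "a2 \<in> A"
        using a(5) by (simp add: A_def)
      show "X a2 \<noteq> Zer"
        using a(5) by simp
      show "supp Y1 \<subseteq> A \<union> B"
        unfolding sy using a(4) by (auto simp: A_def)
      show "Y1 a2 = Zer"
      proof -
        have "a2 \<notin> supp Y1"
          unfolding sy using a(3,5) by (auto simp: B_def)
        then show ?thesis by simp
      qed
      fix b' assume b': "b' \<in> B"
      then obtain Z where Z: "is_pivot X b' (Y b') Z c"
        using all by blast
      note z = is_pivotD[OF Z]
      have "Y1 b' = Y b'"
        using y(5)[of b'] b' cAB(2) Y by blast
      moreover have "supp Z = insert b' A"
        using z(3) X cAB b' by blast
      moreover have "Z a2 = X a2"
        using z(5)[of a2] a(5) cAB(1) unfolding A_def by blast
      ultimately show "\<exists>Z\<in>C. supp Z = insert b' A \<and> Z a2 = X a2 \<and> Z b' = Y1 b'"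
        using z by auto
    qed
  qed
  then obtain b' where b': "b' \<in> B" "\<And>Z. \<not> is_pivot X b' (Y b') Z c"
    by blast
  then have "b' \<noteq> b"
    using b by blast
  note x = is_pivotD[OF b(1)]
  have sx: "supp X' = insert b A"
    using b(2) cAB unfolding x(3) X B_def by blast
  have "b' \<in> E" "b' \<notin> supp X'" "Y b' \<noteq> Zer"
    using b'(1) supp_subset[OF C(2)] \<open>b' \<noteq> b\<close> cAB(3) unfolding sx B_def by auto
  then obtain V l where V: "is_pivot X' b' (Y b') V l"
    using ex_pivot[OF x(1)] by blast
  note v = is_pivotD[OF V]
  have XA: "X' f = X f" if "f \<in> A" for f
    using x(5)[of f] that cAB(1) X by blast
  have bB: "b \<in> B"
    using b(2) by (simp add: B_def)
  \<comment> \<open>If \<open>b\<close> left again, \<open>V\<close> would be the pivot of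
    \<open>X\<close> at \<open>b'\<close> ending in \<open>c\<close>, which the choice of
    \<open>b'\<close> excludes.\<close>
  have "l \<noteq> b"
  proof
    assume l: "l = b"
    have "is_pivot X b' (Y b') V c"
      unfolding is_pivot_def
    proof (intro conjI ballI impI)
      show "supp V = insert b' (supp X) - {c}"
        unfolding v(3) sx l X using b'(1) bB \<open>b' \<noteq> b\<close> cAB by blast
      show "V f = X f" if "f \<in> supp X" "f \<noteq> c" for f
      proof -
        have "f \<in> A" "f \<noteq> b"
          using that bB cAB(3) unfolding X by blast+
        then show ?thesis
          using v(5)[of f] XA[of f] l unfolding sx by simp
      qed
    qed (use v x in auto)
    then show False
      using b'(2) by blast
  qed
  have lA: "l \<in> A"
    using v(2) \<open>l \<noteq> b\<close> unfolding sx by blast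
  \<comment> \<open>Two candidates are supplied so that one avoids \<open>l\<close>; then
    \<open>a\<close> lies in both supports and only \<open>b\<close>, \<open>b'\<close> and
    \<open>a\<close> are common. Nothing separates \<open>V\<close> from \<open>Y'\<close>, so the
    plane costs three steps and the total is \<open>1 + 1 + 3 + 1\<close>.\<close>
  obtain a Y' where a': "is_pivot Y a (X a) Y' c" "a \<in> A" "a \<noteq> l"
    using a unfolding A_def by (metis (no_types, lifting))
  note y = is_pivotD[OF a'(1)]
  have sy: "supp Y' = insert a B"
    using a'(2) cAB(1,2) unfolding y(3) Y by blast
  have sv: "supp V = insert b' (insert b A) - {l}"
    unfolding v(3) sx by blast
  have "supp Y' - supp V = B - {b, b'}"
    unfolding sy sv using a'(2,3) cAB(3) lA by blast
  then have "card (supp Y' - supp V) = 2"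
    using bB b'(1) \<open>b' \<noteq> b\<close> k fin by (simp add: card_Diff_subset B_def)
  note plane = reach_plane[OF v(1) y(1) this]
  have "sep V Y' = {}"
  proof (rule equals0I)
    fix f assume f: "f \<in> sep V Y'"
    then have "f \<in> supp V" "f \<in> supp Y'" and ne: "V f \<noteq> Y' f"
      by auto
    then consider "f = a" | "f = b" | "f = b'"
      unfolding sv sy using cAB(3) by blast
    then show False
    proof cases
      case 1
      then have "V f = X f"
        using v(5)[of f] XA[of f] a'(2,3) unfolding sx by auto
      then show False
        using ne 1 y(4) by simp
    next
      case 2
      then have "V f = Y f"
        using v(5)[of f] x(4) \<open>l \<noteq> b\<close> unfolding sx by auto
      moreover have "Y' f = Y f"
        using y(5)[of f] 2 bB cAB(2) unfolding Y by blast
      ultimately show False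
        using ne by simp
    next
      case 3
      moreover have "Y' f = Y f"
        using y(5)[of f] 3 b'(1) cAB(2) unfolding Y by blast
      ultimately show False
        using ne v(4) by simp
    qed
  qed
  then have r: "reach V Y' 3"
    using plane d by simp
  have r': "reach X X' 1" "reach X' V 1" "reach Y' Y 1"
    using reach_pivot[OF C(1) _ b(1)] reach_pivot[OF x(1) \<open>b' \<notin> supp X'\<close> V]
      reach_sym[OF reach_pivot[OF C(2) _ a'(1)]] b(2) a'(2) unfolding A_def by blast+
  show ?thesis
    using reach_trans[OF reach_trans[OF reach_trans[OF r'(1,2)] r] r'(3)] d by simp
qed

lemma ex_two_exceptions:
  assumes "2 < card S" "\<forall>x\<in>S. \<forall>y\<in>S. Q x \<and> Q y \<longrightarrow> x = y"
  shows "\<exists>x\<in>S. \<exists>y\<in>S. x \<noteq> y \<and> \<not> Q x \<and> \<not> Q y"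
proof -
  obtain T where T: "T \<subseteq> S" "card T = 3"
    using obtain_subset_with_card_n[of 3 S] assms(1) by auto
  then obtain x y z where "T = {x, y, z}" "x \<noteq> y" "x \<noteq> z" "y \<noteq> z"
    by (auto simp: card_3_iff)
  moreover from this have "x \<in> S" "y \<in> S" "z \<in> S"
    using T(1) by auto
  ultimately show ?thesis
    using assms(2) by metis
qed

text \<open>If the bound fails, the supports share a single element \<open>c\<close>, and
  \<open>c\<close> separates. \<open>Q X Y b\<close> says that the pivot of \<open>X\<close> at
  \<open>b\<close> towards \<open>Y\<close> leaves outside \<open>supp Y\<close>. Two such
  \<open>b\<close> would give a short path, so all but one of these pivots end in \<open>c\<close>,
  and likewise from \<open>Y\<close>. This is the configuration of
  \<open>reach_4_wall\<close>.\<close>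

lemma reach_4:
  assumes C: "X \<in> C" "Y \<in> C" and k: "card (supp Y - supp X) = 4" and d: "d \<le> 4"
  shows "reach X Y (Suc (Suc d))"
proof (rule ccontr)
  assume no: "\<not> reach X Y (Suc (Suc d))"
  have k': "card (supp X - supp Y) = 4"
    using card_supp_Diff(1)[OF C] k by simp
  have K: "card (supp X \<inter> supp Y) + 4 = Suc d"
    using card_supp_Diff(2)[OF C] k by simp
  have fin: "finite (supp X \<inter> supp Y)"
    using C finite_supp by blast
  have "sep X Y \<noteq> {}"
    using reach_4_same_tope[OF C k d] no by blast
  then obtain c where c: "c \<in> sep X Y"
    by blast
  then have cK: "c \<in> supp X \<inter> supp Y"
    by simp
  then have "card (supp X \<inter> supp Y) \<noteq> 0"
    using fin by auto
  then have d4: "d = 4" and "card (supp X \<inter> supp Y) = 1"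
    using K d by auto
  then have Kc: "supp X \<inter> supp Y = {c}"
    using cK by (metis card_1_singletonE singletonD)
  have s: "sep X Y \<subseteq> {c}"
    unfolding Kc[symmetric] by auto
  then have s: "card (sep X Y) \<le> d - 3" "card (sep Y X) \<le> d - 3"
    using card_mono[of "{c}" "sep X Y"] d4 by (auto simp: sep_commute[of Y X])
  define Q where "Q X Y b \<longleftrightarrow> (\<exists>Z a. is_pivot X b (Y b) Z a \<and> a \<notin> supp Y)" for X Y b
  have 1: "x = y" if "x \<in> supp Y - supp X" "y \<in> supp Y - supp X" "Q X Y x" "Q X Y y" for x y
    using that reach_4_two_pivots[OF C k d, where s = "Y x" and s' = "Y y" and b = x and b' = y] s no
    unfolding Q_def by auto
  have no': "\<not> reach Y X (Suc (Suc d))"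
    using no reach_sym by blast
  have 2: "x = y" if "x \<in> supp X - supp Y" "y \<in> supp X - supp Y" "Q Y X x" "Q Y X y" for x y
    using that reach_4_two_pivots[OF C(2,1) k' d, where s = "X x" and s' = "X y" and b = x and b' = y] s no'
    unfolding Q_def by auto
  have ex: "\<exists>Z. is_pivot X b (Y b) Z c" if "X \<in> C" "Y \<in> C" "b \<in> supp Y - supp X" "\<not> Q X Y b" "supp X \<inter> supp Y = {c}"
    for X Y b
  proof -
    have "b \<in> E" "b \<notin> supp X" "Y b \<noteq> Zer"
      using that supp_subset[of Y] by auto
    then obtain Z a where Z: "is_pivot X b (Y b) Z a"
      using ex_pivot[of X b "Y b"] \<open>X \<in> C\<close> by metis
    then have "a \<in> supp X \<inter> supp Y"
      using that(4) is_pivotD(2)[OF Z] unfolding Q_def by blast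
    then have "a = c"
      using that(5) by simp
    then show ?thesis
      using Z by blast
  qed
  have "2 < card (supp Y - supp X)" "2 < card (supp X - supp Y)"
    using k k' by simp_all
  note exc = ex_two_exceptions[OF this(1), of "Q X Y"] ex_two_exceptions[OF this(2), of "Q Y X"]
  obtain b where b: "b \<in> supp Y - supp X" "\<not> Q X Y b"
    using exc(1) 1 by metis
  obtain a a' where a: "a \<in> supp X - supp Y" "a' \<in> supp X - supp Y" "a \<noteq> a'" "\<not> Q Y X a" "\<not> Q Y X a'"
    using exc(2) 2 by metis
  have Kc': "supp Y \<inter> supp X = {c}"
    using Kc by (simp add: Int_commute)
  obtain X' Y1 Y2 where piv: "is_pivot X b (Y b) X' c" "is_pivot Y a (X a) Y1 c" "is_pivot Y a' (X a') Y2 c"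
    using ex[OF C b Kc] ex[OF C(2,1) a(1,4) Kc'] ex[OF C(2,1) a(2,5) Kc'] by blast
  show False
    using reach_4_wall[OF C k d4 Kc piv(1) b(1) piv(2,3) a(3,1,2)] no by blast
qed

section \<open>Disjoint supports of five elements\<close>

text \<open>If \<open>g\<close> differs on \<open>w\<close> and \<open>x\<close>, it is constant on
  the remaining three elements \<open>y\<close>, \<open>z\<close>, \<open>u\<close>; and one of
  \<open>w\<close>, \<open>x\<close> has that same value, since otherwise the pairs
  \<open>w, y\<close> and \<open>x, z\<close> would both be unequal.\<close>

lemma constant_except_one:
  assumes S: "card S = 5"
    and no: "\<And>w x y z. {w, x, y, z} \<subseteq> S \<Longrightarrow> {w, x} \<inter> {y, z} = {} \<Longrightarrow> g w \<noteq> g x \<Longrightarrow> g y \<noteq> g z \<Longrightarrow> False"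
  obtains b0 v where "b0 \<in> S" "\<And>b. b \<in> S \<Longrightarrow> b \<noteq> b0 \<Longrightarrow> g b = v"
proof (cases "\<exists>w\<in>S. \<exists>x\<in>S. g w \<noteq> g x")
  case False
  moreover obtain b0 where "b0 \<in> S"
    using S by fastforce
  ultimately show thesis
    using that by blast
next
  case True
  then obtain w x where w: "w \<in> S" "x \<in> S" "g w \<noteq> g x"
    by blast
  have "finite S" "w \<noteq> x"
    using S w by (auto intro: card_ge_0_finite)
  then have "card (S - {w, x}) = 3"
    using w S by (simp add: card_Diff_subset)
  then obtain y z u where R: "S - {w, x} = {y, z, u}" "y \<noteq> z" "z \<noteq> u" "y \<noteq> u"
    by (auto simp: card_3_iff)
  have eq: "g b = g y" if "b \<in> S - {w, x}" for b
  proof (rule ccontr)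
    assume "g b \<noteq> g y"
    moreover have "y \<in> S - {w, x}"
      unfolding R(1) by blast
    ultimately show False
      using no[of w x b y] w that by auto
  qed
  have "g w = g y \<or> g x = g y"
  proof (rule ccontr)
    assume "\<not> ?thesis"
    moreover have "y \<in> S - {w, x}" "z \<in> S - {w, x}"
      unfolding R(1) by blast+
    ultimately show False
      using no[of w y x z] eq[of z] w R(2) \<open>w \<noteq> x\<close> by auto
  qed
  then show thesis
  proof
    assume "g w = g y"
    then show thesis
      using that[of x "g y"] eq w by blast
  next
    assume "g x = g y"
    then show thesis
      using that[of w "g y"] eq w by blast
  qed
qed

text \<open>\<open>\<alpha> b\<close> is the element reached from \<open>X\<close> when \<open>b\<close> becomes nonzero with its sign in \<open>Y\<close>. If
  \<open>\<alpha> w \<noteq> \<alpha> x\<close> and \<open>\<alpha> y \<noteq> \<alpha> z\<close>, then two pivots from \<open>X\<close>, using either \<open>w, x\<close> or \<open>y, z\<close>, combine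
  with one pivot from \<open>Y\<close>; otherwise \<open>\<alpha>\<close> is constant up to one element and three pivots
  from \<open>X\<close> work.\<close>

lemma reach_5:
  assumes C: "X \<in> C" "Y \<in> C" and k: "card (supp Y - supp X) = 5" and d: "d \<le> 4"
  shows "reach X Y (Suc (Suc d))"
proof (rule ccontr)
  assume no: "\<not> reach X Y (Suc (Suc d))"
  define A where "A = supp X"
  define B where "B = supp Y"
  have fin: "finite A" "finite B"
    using C finite_supp by (auto simp: A_def B_def)
  have d4: "d = 4" and "card (supp X \<inter> supp Y) = 0"
    using card_supp_Diff(2)[OF C] k d by auto
  then have AB: "A \<inter> B = {}"
    using fin unfolding A_def B_def by simp
  have cA: "card A = 5" and cB: "card B = 5"
    using card_supp C d4 by (auto simp: A_def B_def)
  have AE: "A \<subseteq> E" "B \<subseteq> E"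
    using supp_subset C by (auto simp: A_def B_def)
  have nzX: "X a \<noteq> Zer" if "a \<in> A" for a
    using that by (simp add: A_def)
  have nzY: "Y b \<noteq> Zer" if "b \<in> B" for b
    using that by (simp add: B_def)
  have YZ: "Y a = Zer" if "a \<in> A" for a
    using AB that supp_iff[of a Y] unfolding B_def by blast

  \<comment> \<open>Three steps for the pivots at both ends and three for a plane without separating
    elements make \<open>d + 2 = 6\<close>.\<close>
  have close: False
    if Z: "Z \<in> C" "Z' \<in> C" "reach X Z j" "reach Z' Y i" "j + i \<le> 3"
      and XY: "\<And>f. f \<in> supp Z \<Longrightarrow> f \<in> supp Z' \<Longrightarrow> Z f = Z' f"
      and two: "card (supp Z' - supp Z) = 2" for Z Z' j i
  proof -
    have "sep Z Z' = {}"
      using XY by auto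
    then have "reach Z Z' 3"
      using reach_plane[OF Z(1,2) two] d4 by simp
    from reach_trans[OF reach_trans[OF Z(3) this] Z(4)] show False
      using no d4 Z(5) reach_mono[of X Y "j + 3 + i" "Suc (Suc d)"] by simp
  qed

  have "\<exists>Z a. is_pivot X b (Y b) Z a" if "b \<in> B" for b
  proof -
    have "b \<in> E" "b \<notin> supp X"
      using that AE AB unfolding A_def by blast+
    then show ?thesis
      using ex_pivot[OF C(1)] nzY[OF that] by metis
  qed
  then obtain Z \<alpha> where piv: "\<And>b. b \<in> B \<Longrightarrow> is_pivot X b (Y b) (Z b) (\<alpha> b)"
    by metis
  have Zp: "Z b \<in> C" "\<alpha> b \<in> A" "supp (Z b) = insert b A - {\<alpha> b}" "Z b b = Y b" "reach X (Z b) 1"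
    "\<And>f. f \<in> A \<Longrightarrow> f \<noteq> \<alpha> b \<Longrightarrow> Z b f = X f"
    if b: "b \<in> B" for b
    using is_pivotD[OF piv[OF b]] reach_pivot[OF C(1) _ piv[OF b]] AB b unfolding A_def by blast+

  have step2: "\<exists>V l. V \<in> C \<and> l \<in> A \<and> l \<noteq> \<alpha> b \<and> supp V = insert b' (insert b A) - {\<alpha> b, l}
      \<and> V b = Y b \<and> V b' = Y b' \<and> (\<forall>f\<in>A. f \<noteq> \<alpha> b \<longrightarrow> f \<noteq> l \<longrightarrow> V f = X f) \<and> reach X V 2"
    if b: "b \<in> B" "b' \<in> B" "\<alpha> b \<noteq> \<alpha> b'" for b b'
  proof -
    have nb: "b \<notin> A" "b' \<notin> A" "b \<noteq> b'"
      using b AB by auto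
    have b'Z: "b' \<notin> supp (Z b)"
      unfolding Zp(3)[OF b(1)] using nb by blast
    then obtain V l where V: "is_pivot (Z b) b' (Y b') V l"
      using ex_pivot[OF Zp(1)[OF b(1)] _ b'Z nzY[OF b(2)]] b(2) AE by blast
    note v = is_pivotD[OF V]
    \<comment> \<open>If \<open>b\<close> left again, \<open>V\<close> would be the pivot of
      \<open>X\<close> at \<open>b'\<close> with leaving element \<open>\<alpha> b\<close>, and
      uniqueness would give \<open>\<alpha> b = \<alpha> b'\<close>.\<close>
    have "l \<noteq> b"
    proof
      assume l: "l = b"
      have "is_pivot X b' (Y b') V (\<alpha> b)"
        unfolding is_pivot_def
      proof (intro conjI ballI impI)
        show "supp V = insert b' (supp X) - {\<alpha> b}"
          unfolding v(3) Zp(3)[OF b(1)] l A_def[symmetric] using nb Zp(2)[OF b(1)] b(2) AB by blast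
        show "\<alpha> b \<in> supp X"
          using Zp(2)[OF b(1)] by (simp add: A_def)
        fix f assume f: "f \<in> supp X" "f \<noteq> \<alpha> b"
        then have "f \<in> A" "f \<in> supp (Z b)" "f \<noteq> l"
          unfolding Zp(3)[OF b(1)] l using nb by (auto simp: A_def)
        then show "V f = X f"
          using v(5)[of f] Zp(6)[OF b(1), of f] f by simp
      qed (use v in auto)
      then show False
        using is_pivot_unique[OF C(1) _ piv[OF b(2)]] nb b(3) unfolding A_def by metis
    qed
    then have l: "l \<in> A" "l \<noteq> \<alpha> b"
      using v(2) unfolding Zp(3)[OF b(1)] by blast+
    have "supp V = insert b' (insert b A) - {\<alpha> b, l}"
      unfolding v(3) Zp(3)[OF b(1)] using b(2) Zp(2)[OF b(1)] nb by blast
    moreover have "V b = Y b"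
      using v(5)[of b] Zp(4)[OF b(1)] nzY[OF b(1)] \<open>l \<noteq> b\<close> by simp
    moreover have "V f = X f" if "f \<in> A" "f \<noteq> \<alpha> b" "f \<noteq> l" for f
    proof -
      have "f \<in> supp (Z b)"
        unfolding Zp(3)[OF b(1)] using that by blast
      then show ?thesis
        using v(5)[of f] Zp(6)[OF b(1), of f] that by simp
    qed
    moreover have "reach X V 2"
      using reach_trans[OF Zp(5)[OF b(1)] reach_pivot[OF Zp(1)[OF b(1)] b'Z V]] by (simp add: numeral_2_eq_2)
    ultimately show ?thesis
      using v(1,4) l by blast
  qed

  have pair: False
    if b: "w \<in> B" "x \<in> B" "y \<in> B" "z \<in> B" "{w, x} \<inter> {y, z} = {}" "\<alpha> w \<noteq> \<alpha> x" "\<alpha> y \<noteq> \<alpha> z" for w x y z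
  proof -
    obtain V l where V: "V \<in> C" "l \<in> A" "l \<noteq> \<alpha> w" "supp V = insert x (insert w A) - {\<alpha> w, l}"
      "V w = Y w" "V x = Y x" "\<And>f. f \<in> A \<Longrightarrow> f \<noteq> \<alpha> w \<Longrightarrow> f \<noteq> l \<Longrightarrow> V f = X f" "reach X V 2"
      using step2[OF b(1,2,6)] by blast
    obtain V' l' where V': "V' \<in> C" "l' \<in> A" "l' \<noteq> \<alpha> y" "supp V' = insert z (insert y A) - {\<alpha> y, l'}"
      "V' y = Y y" "V' z = Y z" "\<And>f. f \<in> A \<Longrightarrow> f \<noteq> \<alpha> y \<Longrightarrow> f \<noteq> l' \<Longrightarrow> V' f = X f" "reach X V' 2"
      using step2[OF b(3,4,7)] by blast
    \<comment> \<open>\<open>A\<close> has five elements, so some \<open>a\<close> stays in the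
      support through both pairs of pivots. The pivot of \<open>Y\<close> at \<open>a\<close> loses
      one element \<open>\<beta>\<close>, which lies in at most one of the disjoint pairs; the other
      pair leads to a plane without separating elements.\<close>
    have "card {\<alpha> w, l, \<alpha> y, l'} \<le> 4"
      by (simp add: card_insert_if)
    then have "\<not> A \<subseteq> {\<alpha> w, l, \<alpha> y, l'}"
      using card_mono[of "{\<alpha> w, l, \<alpha> y, l'}" A] cA by fastforce
    then obtain a where a: "a \<in> A" "a \<notin> {\<alpha> w, l, \<alpha> y, l'}"
      by blast
    have aY: "a \<in> E" "a \<notin> supp Y"
      using a(1) AE AB unfolding B_def by blast+
    then obtain W \<beta> where W: "is_pivot Y a (X a) W \<beta>"
      using ex_pivot[OF C(2) aY nzX[OF a(1)]] by blast
    note w = is_pivotD[OF W]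
    have r: "reach W Y 1"
      using reach_sym[OF reach_pivot[OF C(2) aY(2) W]] .
    have fin: False
      if U: "U \<in> C" "supp U = insert v (insert u A) - {m, m'}" "U u = Y u" "U v = Y v" "U a = X a"
        "reach X U 2" and uv: "u \<in> B" "v \<in> B" "u \<noteq> v" "\<beta> \<noteq> u" "\<beta> \<noteq> v" "m \<in> A" "m' \<in> A" "a \<noteq> m" "a \<noteq> m'"
      for U u v m m'
    proof (rule close[OF U(1) w(1) U(6) r])
      have "supp W - supp U = B - {\<beta>, u, v}"
        unfolding w(3) U(2) B_def[symmetric] using a(1) uv AB by blast
      moreover have "\<beta> \<in> B"
        using w(2) by (simp add: B_def)
      ultimately show "card (supp W - supp U) = 2"
        using uv cB fin by (simp add: card_Diff_subset)
      fix f assume f: "f \<in> supp U" "f \<in> supp W"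
      then consider "f = a" | "f = u" | "f = v"
        unfolding w(3) U(2) B_def[symmetric] using AB by blast
      then show "U f = W f"
        using U(3-5) w(4) w(5)[of u] w(5)[of v] uv unfolding B_def by cases auto
    qed simp
    have "\<alpha> w \<in> A" "\<alpha> y \<in> A"
      using Zp(2) b by auto
    then show False
      using fin[OF V(1,4,5,6) V(7)[OF a(1)] V(8) b(1,2)] fin[OF V'(1,4,5,6) V'(7)[OF a(1)] V'(8) b(3,4)]
        a b(5-7) V(2) V'(2) by auto
  qed

  obtain b0 v where b0: "b0 \<in> B" "\<And>b. b \<in> B \<Longrightarrow> b \<noteq> b0 \<Longrightarrow> \<alpha> b = v"
    using constant_except_one[OF cB, of \<alpha>] pair by (metis insert_subset)
  have B0: "card (B - {b0}) = 4"
    using b0(1) cB fin by simp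
  then obtain b where b: "b \<in> B" "b \<noteq> b0"
    by (metis Diff_iff all_not_in_conv card.empty insertI1 zero_neq_numeral)
  have vA: "v \<in> A"
    using Zp(2)[OF b(1)] b0(2)[OF b] by simp
  \<comment> \<open>Otherwise all five pivots towards \<open>Y\<close> end in \<open>v\<close>, and
    \<open>simplex\<close> applies with \<open>A - {v}\<close>, on which \<open>Y\<close>
    vanishes.\<close>
  have "\<alpha> b0 \<noteq> v"
  proof
    assume v: "\<alpha> b0 = v"
    have \<alpha>: "\<alpha> b' = v" if "b' \<in> B" for b'
      using b0(2)[OF that] v by metis
    have cS: "card (A - {v}) = 4"
      using vA cA fin by simp
    then obtain s0 where s0: "s0 \<in> A - {v}"
      by (metis all_not_in_conv card.empty zero_neq_numeral)
    show False
    proof (rule simplex[of "A - {v}" s0 "X s0" B Y])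
      fix b' assume b': "b' \<in> B"
      have "supp (Z b') = insert b' (A - {v})"
        unfolding Zp(3)[OF b'] \<alpha>[OF b'] using vA b' AB by blast
      then show "\<exists>Z\<in>C. supp Z = insert b' (A - {v}) \<and> Z s0 = X s0 \<and> Z b' = Y b'"
        using Zp[OF b'] \<alpha>[OF b'] s0 by auto
    qed (use cS d4 fin s0 nzX AB C(2) YZ B_def in auto)
  qed
  then have ne: "\<alpha> b \<noteq> \<alpha> b0"
    using b0(2)[OF b] by simp
  obtain V l where V: "V \<in> C" "l \<in> A" "l \<noteq> v" "supp V = insert b0 (insert b A) - {v, l}"
    "V b = Y b" "V b0 = Y b0" "\<And>f. f \<in> A \<Longrightarrow> f \<noteq> v \<Longrightarrow> f \<noteq> l \<Longrightarrow> V f = X f" "reach X V 2"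
    using step2[OF b(1) b0(1) ne] unfolding b0(2)[OF b] by blast
  \<comment> \<open>The aim is a second simplex, now at \<open>V\<close>: every further pivot
    towards \<open>Y\<close> will be shown to lose \<open>b\<close>, so that its support is
    \<open>insert b' S\<close>. The remaining case \<open>b' = b\<close> is \<open>V\<close>
    itself.\<close>
  define S where "S = insert b0 (A - {v, l})"
  have cS': "card (A - {v, l}) = 3"
    using vA V(2,3) cA fin by (simp add: card_Diff_subset)
  have nbA: "b \<notin> A" "b0 \<notin> A"
    using b b0 AB by auto
  have cS: "card S = 4"
    unfolding S_def using cS' fin nbA by simp
  obtain s0 where s0: "s0 \<in> A - {v, l}"
    using cS' by (metis all_not_in_conv card.empty zero_neq_numeral)
  have "\<exists>W\<in>C. supp W = insert b' S \<and> W s0 = X s0 \<and> W b' = Y b'" if b': "b' \<in> B - {b0}" for b'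
  proof (cases "b' = b")
    case True
    have "supp V = insert b S"
      unfolding V(4) S_def using nbA vA V(2) by blast
    then show ?thesis
      using V s0 True by auto
  next
    case False
    have b'': "b' \<in> B" "b' \<noteq> b0" "b' \<noteq> b" "b' \<notin> A"
      using False b' AB by auto
    then have b'V: "b' \<notin> supp V"
      unfolding V(4) by blast
    then obtain W x where W: "is_pivot V b' (Y b') W x"
      using ex_pivot[OF V(1) _ b'V nzY[OF b''(1)]] b''(1) AE by blast
    note w = is_pivotD[OF W]
    have r: "reach X W 3"
      using reach_trans[OF V(8) reach_pivot[OF V(1) b'V W]] by (simp add: numeral_3_eq_3 numeral_2_eq_2)
    have Vf: "f \<in> supp V" if "f \<in> {b, b0} \<or> f \<in> A - {v, l}" for f
      unfolding V(4) using that nbA vA V(2) by blast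
    \<comment> \<open>A third pivot losing an element of \<open>A\<close> gains a third element of
      \<open>B\<close>, which leaves a plane between \<open>W\<close> and \<open>Y\<close> with no
      separating element.\<close>
    have "x \<notin> A"
    proof
      assume x: "x \<in> A"
      show False
      proof (rule close[OF w(1) C(2) r reach_refl[of Y 0]])
        have "supp Y - supp W = B - {b, b0, b'}"
          unfolding w(3) V(4) B_def[symmetric] using AB x b b0(1) vA V(2) b'' by blast
        then show "card (supp Y - supp W) = 2"
          using b b0(1) b'' cB fin by (simp add: card_Diff_subset)
        fix f assume f: "f \<in> supp W" "f \<in> supp Y"
        then have "f \<in> {b, b0, b'}" "f \<noteq> x"
          unfolding w(3) V(4) B_def[symmetric] using AB by blast+
        then show "W f = Y f"
          using w(4) w(5)[of f] V(5,6) Vf[of f] by auto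
      qed simp
    qed
    have xV: "x = b \<or> x = b0"
      using w(2) \<open>x \<notin> A\<close> unfolding V(4) by blast
    have Wf: "W f = X f" if "f \<in> A - {v, l}" for f
      using w(5)[of f] V(7)[of f] Vf[of f] \<open>x \<notin> A\<close> that by auto
    \<comment> \<open>If \<open>b0\<close> left, \<open>Z b\<close>, \<open>Z b'\<close> and
      \<open>W\<close> would lie on one line and agree pairwise at \<open>l\<close>,
      \<open>b\<close> and \<open>b'\<close>; this uses that \<open>b\<close> and \<open>b'\<close>
      have the same leaving element \<open>v\<close>.\<close>
    have "x \<noteq> b0"
    proof
      assume x: "x = b0"
      have \<alpha>: "\<alpha> b = v" "\<alpha> b' = v"
        using b0(2) b b'' by auto
      define U where "U = insert b (insert b' (A - {v}))"
      have "Z b' b' \<noteq> W b'"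
      proof (rule line_triangle[of "Z b" "Z b'" W U b' b l])
        show "card U = Suc (Suc d)"
          unfolding U_def using vA cA fin nbA b'' d4 by simp
        show "supp (Z b) = U - {b'}" "supp (Z b') = U - {b}" "supp W = U - {l}"
          unfolding U_def Zp(3)[OF b(1)] Zp(3)[OF b''(1)] \<alpha> w(3) V(4) x
          using vA V(2,3) nbA b b'' by blast+
        show "Z b l = Z b' l"
          using Zp(6)[OF b(1), of l] Zp(6)[OF b''(1), of l] \<alpha> V(2,3) by simp
        show "Z b b = W b"
          using Zp(4)[OF b(1)] w(5)[of b] V(5) Vf[of b] x b(2) by simp
      qed (use Zp(1) b b'' w(1) V(2,3) nbA in \<open>auto simp: U_def\<close>)
      then show False
        using Zp(4)[OF b''(1)] w(4) by simp
    qed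
    then have "x = b"
      using xV by blast
    then have "supp W = insert b' S"
      unfolding w(3) V(4) S_def using nbA vA V(2) b b'' by blast
    then show ?thesis
      using w(1,4) Wf[OF s0] by blast
  qed
  then show False
    using simplex[of S s0 "X s0" "B - {b0}" Y] cS d4 fin s0 nzX AB C(2) YZ nbA
    unfolding S_def B_def[symmetric] by (auto simp: B_def[symmetric])
qed

subsection \<open>The diameter\<close>

lemma reach_all:
  assumes C: "X \<in> C" "Y \<in> C" and d: "d \<le> 4"
  shows "reach X Y (Suc (Suc d))"
proof -
  have "card (supp Y - supp X) \<le> 5"
    using card_supp_Diff(2)[OF C] d by linarith
  then consider "card (supp Y - supp X) = 0" | "card (supp Y - supp X) = 1" | "card (supp Y - supp X) = 2"
    | "card (supp Y - supp X) = 3" | "card (supp Y - supp X) = 4" | "card (supp Y - supp X) = 5"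
    by linarith
  then show ?thesis
  proof cases
    case 1
    then have "supp Y \<subseteq> supp X"
      using finite_supp[OF C(2)] by simp
    then have "supp Y = supp X"
      using card_subset_eq finite_supp[OF C(1)] card_supp C by metis
    then show ?thesis
      using same_supp[OF C(2,1)] reach_refl reach_neg[OF C(1)] by auto
  next
    case 2
    have "sep X Y \<subseteq> supp X \<inter> supp Y"
      by auto
    then have "card (sep X Y) \<le> card (supp X \<inter> supp Y)"
      using card_mono finite_supp[OF C(1)] by blast
    then have "card (sep X Y) \<le> d"
      using card_supp_Diff(2)[OF C] 2 by simp
    moreover have "reach X Y (Suc (card (sep X Y)))"
      using reach_line[OF C] card_supp_Diff(3)[OF C] 2 by simp
    ultimately show ?thesis
      using reach_mono by simp
  next
    case 3
    have "sep X Y \<subseteq> supp X \<inter> supp Y"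
      by auto
    then have "card (sep X Y) \<le> card (supp X \<inter> supp Y)"
      using card_mono finite_supp[OF C(1)] by blast
    then have "card (sep X Y) + 1 \<le> d"
      using card_supp_Diff(2)[OF C] 3 by simp
    then show ?thesis
      by (intro reach_mono[OF reach_plane[OF C 3 d]]) linarith
  qed (use reach_3[OF C _ d] reach_4[OF C _ d] reach_5[OF C _ d] in blast)+
qed

text \<open>\<open>Y\<close> has \<open>r - 1\<close> zeros, and adjacency makes at least
  \<open>r - 2\<close> of them zeros of \<open>X\<close>.\<close>

lemma adj_enters_one:
  assumes "cocircuit_adj E C X Y" "e \<in> supp X" "f \<in> supp X" "Y e = Zer" "Y f = Zer"
  shows "e = f"
proof (rule ccontr)
  assume "e \<noteq> f"
  have XY: "X \<in> C" "Y \<in> C" "om_rank C - 2 \<le> card (zerop E X \<inter> zerop E Y)"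
    using assms(1) by (auto simp: cocircuit_adj_def)
  have "zerop E Y = E - supp Y"
    by (auto simp: zerop_def)
  then have "card (zerop E Y) = om_rank C - 1"
    using card_supp[OF XY(2)] supp_subset[OF XY(2)] card_E finite_supp[OF XY(2)]
    by (simp add: card_Diff_subset)
  moreover have "zerop E X \<inter> zerop E Y \<subseteq> zerop E Y - {e, f}"
    using assms(2,3) by (auto simp: zerop_def)
  then have "card (zerop E X \<inter> zerop E Y) \<le> card (zerop E Y - {e, f})"
    using finite_E by (intro card_mono) (auto simp: zerop_def)
  moreover have "{e, f} \<subseteq> zerop E Y"
    using assms supp_subset[OF XY(1)] by (auto simp: zerop_def)
  then have "card (zerop E Y - {e, f}) = card (zerop E Y) - 2" "2 \<le> card (zerop E Y)"
    using \<open>e \<noteq> f\<close> finite_E card_mono[of "zerop E Y" "{e, f}"] by (auto simp: card_Diff_subset zerop_def)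
  ultimately show False
    using XY(3) by linarith
qed

text \<open>Adjacent cocircuits are not separated, so a sign can flip only by passing through zero.
  The map \<open>t\<close> picks a step at which \<open>e\<close> becomes zero; it is injective by
  \<open>adj_enters_one\<close> and never takes the last step, which ends in
  \<open>neg X\<close>.\<close>

lemma walk_neg_length:
  assumes X: "X \<in> C" and walk: "is_walk E C X (neg X) k"
  shows "Suc (Suc d) \<le> k"
proof -
  obtain p where p: "p 0 = X" "p k = neg X" "\<And>i. i < k \<Longrightarrow> cocircuit_adj E C (p i) (p (Suc i))"
    using walk unfolding is_walk_def by blast
  have "\<exists>i. i < k \<and> p i e \<noteq> Zer \<and> p (Suc i) e = Zer" if e: "e \<in> supp X" for e
  proof (rule ccontr)
    assume no: "\<not> ?thesis"
    have "i \<le> k \<Longrightarrow> p i e = X e" for i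
    proof (induction i)
      case (Suc i)
      then have "p i e = X e" "i < k"
        by simp_all
      then have "p (Suc i) e \<noteq> Zer" "e \<notin> sep (p i) (p (Suc i))"
        using no e p(3)[of i] by (auto simp: cocircuit_adj_def)
      then show ?case
        using \<open>p i e = X e\<close> e by simp
    qed (simp add: p)
    from this[of k] show False
      using p(2) e eq_negsv_iff[of "X e" "X e"] by simp
  qed
  then obtain t where t: "\<And>e. e \<in> supp X \<Longrightarrow> t e < k \<and> p (t e) e \<noteq> Zer \<and> p (Suc (t e)) e = Zer"
    by metis
  have "inj_on t (supp X)"
  proof (rule inj_onI)
    fix e f assume "e \<in> supp X" "f \<in> supp X" "t e = t f"
    then show "e = f"
      using t[of e] t[of f] adj_enters_one[OF p(3), of "t e" e f] by simp
  qed
  moreover have "t ` supp X \<subseteq> {..<k - 1}"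
  proof
    fix i assume "i \<in> t ` supp X"
    then obtain e where e: "e \<in> supp X" "i = t e"
      by blast
    then have "Suc i \<noteq> k"
      using t[of e] p(2) by auto
    then show "i \<in> {..<k - 1}"
      using t[OF e(1)] e(2) by auto
  qed
  ultimately have "card (supp X) \<le> k - 1"
    using card_inj_on_le[of t "supp X" "{..<k - 1}"] by simp
  then show ?thesis
    using card_supp[OF X] by simp
qed

lemma is_walk_relpow: "is_walk E C X Y k \<longleftrightarrow> (cocircuit_adj E C ^^ k) X Y"
  unfolding is_walk_def relpowp_fun_conv by blast

lemma cg_diam_eq:
  assumes d: "d \<le> 4"
  shows "cg_diam E C = enat (d + 2)"
proof (rule antisym)
  show "cg_diam E C \<le> enat (d + 2)"
    unfolding cg_diam_def
  proof (intro SUP_least)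
    fix X Y assume "X \<in> C" "Y \<in> C"
    then obtain j where "j \<le> d + 2" "is_walk E C X Y j"
      using reach_all[OF _ _ d] unfolding reach_def is_walk_relpow by force
    then have "cg_dist E C X Y \<le> enat j"
      unfolding cg_dist_def by (intro INF_lower) simp
    also have "\<dots> \<le> enat (d + 2)"
      using \<open>j \<le> d + 2\<close> by simp
    finally show "cg_dist E C X Y \<le> enat (d + 2)" .
  qed
  obtain S where "S \<subseteq> E" "card S = Suc d"
    using obtain_subset_with_card_n[of "Suc d" E] card_E rank_ge_2 by auto
  then obtain X where X: "X \<in> C"
    using ex_supp by blast
  have "enat (d + 2) \<le> cg_dist E C X (neg X)"
    unfolding cg_dist_def using walk_neg_length[OF X] by (intro INF_greatest) simp
  also have "\<dots> \<le> (SUP Y\<in>C. cg_dist E C X Y)"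
    using neg_closed[OF X] by (rule SUP_upper)
  also have "\<dots> \<le> cg_diam E C"
    unfolding cg_diam_def using X by (rule SUP_upper)
  finally show "enat (d + 2) \<le> cg_diam E C" .
qed

end

subsection \<open>Every set of the right size is a support\<close>

locale cocircuits =
  fixes E :: "'a set" and C :: "'a signvec set"
  assumes om: "oriented_matroid E C"
begin

lemmas om_axioms = om[unfolded oriented_matroid_def]

lemma finite_ground: "finite E"
  using om_axioms by (rule conjunct1)

lemma neg_in: "X \<in> C \<Longrightarrow> neg X \<in> C"
  using om_axioms[THEN conjunct2, THEN conjunct2, THEN conjunct2, THEN conjunct1] by (rule bspec)

lemma incomparable:
  assumes "X \<in> C" "Y \<in> C" "supp X \<subseteq> supp Y"
  shows "X = Y \<or> X = neg Y"
  using om_axioms[THEN conjunct2, THEN conjunct2, THEN conjunct2, THEN conjunct2, THEN conjunct1] assms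
  by metis

lemma elim:
  assumes "X \<in> C" "Y \<in> C" "X \<noteq> neg Y" "e \<in> sep X Y"
  shows "\<exists>Z\<in>C. posp Z \<subseteq> (posp X \<union> posp Y) - {e} \<and> negp Z \<subseteq> (negp X \<union> negp Y) - {e}"
  using om_axioms[THEN conjunct2, THEN conjunct2, THEN conjunct2, THEN conjunct2, THEN conjunct2,
      THEN bspec, OF assms(1), THEN bspec, OF assms(2)] assms(3,4)
  by metis

lemma supp_ground:
  assumes "X \<in> C"
  shows "supp X \<subseteq> E"
proof
  fix e assume "e \<in> supp X"
  moreover have "X \<in> signvecs E"
    using om_axioms[THEN conjunct2, THEN conjunct1] assms by (rule subsetD)
  ultimately show "e \<in> E"
    unfolding signvecs_def by auto
qed

lemma supp_subset_eq: "X \<in> C \<Longrightarrow> Y \<in> C \<Longrightarrow> supp X \<subseteq> supp Y \<Longrightarrow> supp X = supp Y"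
  using incomparable[of X Y] by auto

lemma supp_elim:
  assumes C: "X \<in> C" "Y \<in> C" and ne: "supp X \<noteq> supp Y" and e: "e \<in> supp X" "e \<in> supp Y"
  obtains Z where "Z \<in> C" "supp Z \<subseteq> supp X \<union> supp Y - {e}"
proof -
  obtain Y' where Y': "Y' \<in> C" "supp Y' = supp Y" "e \<in> sep X Y'"
  proof (cases "X e = Y e")
    case True
    then have "e \<in> sep X (neg Y)"
      using e eq_negsv_iff by simp
    then show thesis
      using that[of "neg Y"] neg_in[OF C(2)] by simp
  next
    case False
    then show thesis
      using that[of Y] C(2) e by simp
  qed
  have "X \<noteq> neg Y'"
    using ne Y'(2) supp_neg by metis
  then obtain Z where Z: "Z \<in> C" "posp Z \<subseteq> (posp X \<union> posp Y') - {e}" "negp Z \<subseteq> (negp X \<union> negp Y') - {e}"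
    using elim[OF C(1) Y'(1) _ Y'(3)] by blast
  then have "supp Z \<subseteq> supp X \<union> supp Y' - {e}"
    unfolding supp_def by blast
  then show thesis
    using that[OF Z(1)] Y'(2) by simp
qed

text \<open>The classical derivation of strong circuit elimination in a matroid. If weak elimination
  of \<open>e\<close> loses \<open>f\<close>, it yields some \<open>g\<close> in \<open>Y\<close>
  but not in \<open>X\<close>. Eliminating \<open>g\<close> from \<open>Y\<close> and
  \<open>Z\<close> while keeping \<open>e\<close>, and then \<open>e\<close> from \<open>X\<close>
  and the result while keeping \<open>f\<close>, involves smaller unions: the first misses
  \<open>f\<close>, the second \<open>g\<close>.\<close>

lemma supp_strong_elim:
  assumes "X \<in> C" "Y \<in> C" "e \<in> supp X" "e \<in> supp Y" "f \<in> supp X" "f \<notin> supp Y"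
  shows "\<exists>Z\<in>C. f \<in> supp Z \<and> supp Z \<subseteq> supp X \<union> supp Y - {e}"
  using assms
proof (induction "card (supp X \<union> supp Y)" arbitrary: X Y e f rule: less_induct)
  case less
  note C = less.prems(1,2) and ef = less.prems(3-6)
  have fin: "finite (supp X \<union> supp Y)"
    using C supp_ground finite_ground finite_subset by (metis finite_Un)
  have "supp X \<noteq> supp Y"
    using ef by metis
  then obtain Z where Z: "Z \<in> C" "supp Z \<subseteq> supp X \<union> supp Y - {e}"
    using supp_elim C ef by metis
  show ?case
  proof (cases "f \<in> supp Z")
    case True
    then show ?thesis using Z by blast
  next
    case False
    then have "\<not> supp Z \<subseteq> supp X"
      using supp_subset_eq[OF Z(1) C(1)] ef by metis
    then obtain g where g: "g \<in> supp Z" "g \<notin> supp X" "g \<in> supp Y"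
      using Z(2) by blast
    have "supp Y \<union> supp Z \<subset> supp X \<union> supp Y"
      using Z(2) ef False by blast
    then have lt: "card (supp Y \<union> supp Z) < card (supp X \<union> supp Y)"
      by (rule psubset_card_mono[OF fin])
    have "e \<notin> supp Z"
      using Z(2) by blast
    then obtain W where W: "W \<in> C" "e \<in> supp W" "supp W \<subseteq> supp Y \<union> supp Z - {g}"
      using less.hyps[OF lt C(2) Z(1) g(3,1) ef(2)] by blast
    have "supp X \<union> supp W \<subset> supp X \<union> supp Y"
      using Z(2) W(3) g by blast
    then have lt: "card (supp X \<union> supp W) < card (supp X \<union> supp Y)"
      by (rule psubset_card_mono[OF fin])
    have "f \<notin> supp W"
      using W(3) False ef(4) by blast
    then obtain V where "V \<in> C" "f \<in> supp V" "supp V \<subseteq> supp X \<union> supp W - {e}"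
      using less.hyps[OF lt C(1) W(1) ef(1) W(2) ef(3)] by blast
    moreover from this have "supp V \<subseteq> supp X \<union> supp Y - {e}"
      using Z(2) W(3) by blast
    ultimately show ?thesis by blast
  qed
qed

text \<open>Echelon form, which replaces linear independence: \<open>p i\<close> is the pivot of row
  \<open>X i\<close>, and every row vanishes at the pivots of larger index.\<close>

definition triangular :: "nat set \<Rightarrow> (nat \<Rightarrow> 'a signvec) \<Rightarrow> (nat \<Rightarrow> 'a) \<Rightarrow> bool" where
  "triangular I X p \<longleftrightarrow> (\<forall>i\<in>I. X i \<in> C \<and> p i \<in> supp (X i) \<and> (\<forall>j\<in>I. i < j \<longrightarrow> p j \<notin> supp (X i)))"

text \<open>Clearing one column \<open>t\<close> costs one row, the first row \<open>m\<close> that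
  contains \<open>t\<close>. Earlier rows are unchanged, and a later row keeps its pivot under
  strong elimination because row \<open>m\<close> vanishes there.\<close>

lemma gauss_elimination:
  assumes "finite T" "finite I" "triangular I X p"
  shows "\<exists>I' X'. I' \<subseteq> I \<and> triangular I' X' p \<and> card I \<le> card I' + card T \<and>
    (\<forall>i\<in>I'. \<forall>t\<in>T. t \<notin> supp (X' i))"
  using assms(1)
proof (induction T)
  case empty
  then show ?case
    using assms(3) by (intro exI[of _ I] exI[of _ X]) simp
next
  case (insert t T)
  then obtain J Y where J: "J \<subseteq> I" "triangular J Y p" "card I \<le> card J + card T"
    "\<And>i s. i \<in> J \<Longrightarrow> s \<in> T \<Longrightarrow> s \<notin> supp (Y i)"
    by blast
  show ?case
  proof (cases "\<exists>i\<in>J. t \<in> supp (Y i)")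
    case False
    then show ?thesis
      using J insert.hyps by (intro exI[of _ J] exI[of _ Y]) (auto simp del: supp_iff)
  next
    case True
    define m where "m = (LEAST i. i \<in> J \<and> t \<in> supp (Y i))"
    have m: "m \<in> J" "t \<in> supp (Y m)"
      using LeastI_ex[of "\<lambda>i. i \<in> J \<and> t \<in> supp (Y i)"] True unfolding m_def by blast+
    have least: "m \<le> i" if "i \<in> J" "t \<in> supp (Y i)" for i
      unfolding m_def using that by (intro Least_le) blast
    have "\<exists>Z\<in>C. p i \<in> supp Z \<and> t \<notin> supp Z \<and> supp Z \<subseteq> supp (Y i) \<union> supp (Y m) \<and> (i < m \<longrightarrow> Z = Y i)"
      if i: "i \<in> J" "i \<noteq> m" for i
    proof (cases "t \<in> supp (Y i)")
      case True
      then have "m < i"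
        using least[OF i(1)] i(2) by simp
      then have "p i \<notin> supp (Y m)" "p i \<in> supp (Y i)" "Y i \<in> C" "Y m \<in> C"
        using J(2) i(1) m(1) unfolding triangular_def by blast+
      then obtain Z where "Z \<in> C" "p i \<in> supp Z" "supp Z \<subseteq> supp (Y i) \<union> supp (Y m) - {t}"
        using supp_strong_elim[of "Y i" "Y m" t "p i"] True m(2) by blast
      then show ?thesis
        using \<open>m < i\<close> by (intro bexI[of _ Z]) auto
    next
      case False
      then show ?thesis
        using J(2) i unfolding triangular_def by blast
    qed
    then obtain Z where Z: "\<And>i. i \<in> J \<Longrightarrow> i \<noteq> m \<Longrightarrow> Z i \<in> C \<and> p i \<in> supp (Z i) \<and> t \<notin> supp (Z i) \<and>
        supp (Z i) \<subseteq> supp (Y i) \<union> supp (Y m) \<and> (i < m \<longrightarrow> Z i = Y i)"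
      by metis
    have "triangular (J - {m}) Z p"
      unfolding triangular_def
    proof (intro ballI conjI impI)
      fix i j assume ij: "i \<in> J - {m}" "j \<in> J - {m}" "i < j"
      show "p j \<notin> supp (Z i)"
      proof (cases "i < m")
        case True
        then show ?thesis
          using Z[of i] J(2) ij unfolding triangular_def by simp
      next
        case False
        then have "m < j"
          using ij by simp
        then have "p j \<notin> supp (Y i)" "p j \<notin> supp (Y m)"
          using J(2) ij m(1) unfolding triangular_def by blast+
        then show ?thesis
          using Z[of i] ij by blast
      qed
    qed (use Z in blast)+
    moreover have "card I \<le> card (J - {m}) + card (insert t T)"
      using J(3) m(1) insert.hyps finite_subset[OF J(1) assms(2)] by simp
    moreover have "s \<notin> supp (Z i)" if "i \<in> J - {m}" "s \<in> insert t T" for i s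
      using Z[of i] J(4)[of i s] J(4)[of m s] m(1) that by blast
    ultimately show ?thesis
      using J(1) by (intro exI[of _ "J - {m}"] exI[of _ Z]) blast
  qed
qed

section \<open>Chains of covectors and the rank\<close>

lemma supp_foldr_comp: "supp (foldr comp Xs zerovec) = (\<Union>X\<in>set Xs. supp X)"
  by (induction Xs) (auto simp: comp_def zerovec_def split: if_splits)

lemma covector_cocircuit:
  assumes "V \<in> covectors C" "e \<in> supp V"
  obtains X where "X \<in> C" "e \<in> supp X" "supp X \<subseteq> supp V"
proof -
  have "V \<noteq> zerovec"
    using assms(2) by (auto simp: zerovec_def)
  then obtain Xs where Xs: "V = foldr comp Xs zerovec" "set Xs \<subseteq> C"
    using assms(1) unfolding covectors_def by auto
  have V: "supp V = (\<Union>X\<in>set Xs. supp X)"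
    unfolding Xs(1) by (rule supp_foldr_comp)
  then obtain X where "X \<in> set Xs" "e \<in> supp X"
    using assms(2) by blast
  then show thesis
    using that[of X] Xs(2) V by blast
qed

lemma sv_less_supp:
  assumes "sv_less X Y"
  shows "supp X \<subset> supp Y"
proof -
  obtain e where "X e \<noteq> Y e"
    using assms unfolding sv_less_def by blast
  then have "X e = Zer" "Y e \<noteq> Zer"
    using assms unfolding sv_less_def sv_le_def by metis+
  moreover have "supp X \<subseteq> supp Y"
    using assms unfolding sv_less_def sv_le_def by (metis subsetI supp_iff)
  ultimately show ?thesis
    by (metis psubsetI supp_iff)
qed

text \<open>Each step of the chain gains an element \<open>p i\<close>, and some cocircuit that
  contains it has its support inside that of the new covector. It therefore vanishes at all elements
  gained later.\<close>

lemma chain_triangular: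
  assumes "has_chain C k"
  obtains X p where "triangular {..<k} X p" "\<And>i. i < k \<Longrightarrow> p i \<in> E" "inj_on p {..<k}"
proof -
  obtain V where V: "\<And>i. i \<le> k \<Longrightarrow> V i \<in> covectors C" "\<And>i. i < k \<Longrightarrow> sv_less (V i) (V (Suc i))"
    using assms unfolding has_chain_def by blast
  have "\<exists>e X. e \<in> supp (V (Suc i)) - supp (V i) \<and> X \<in> C \<and> e \<in> supp X \<and> supp X \<subseteq> supp (V (Suc i))"
    if "i < k" for i
  proof -
    obtain e where "e \<in> supp (V (Suc i)) - supp (V i)"
      using sv_less_supp[OF V(2)[OF \<open>i < k\<close>]] by blast
    moreover from this obtain X where "X \<in> C" "e \<in> supp X" "supp X \<subseteq> supp (V (Suc i))"
      using covector_cocircuit[OF V(1)[of "Suc i"], of e] \<open>i < k\<close> by auto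
    ultimately show ?thesis by blast
  qed
  then obtain p X where pX: "\<And>i. i < k \<Longrightarrow> p i \<in> supp (V (Suc i)) - supp (V i)"
    "\<And>i. i < k \<Longrightarrow> X i \<in> C" "\<And>i. i < k \<Longrightarrow> p i \<in> supp (X i)" "\<And>i. i < k \<Longrightarrow> supp (X i) \<subseteq> supp (V (Suc i))"
    by metis
  have mono: "supp (V i) \<subseteq> supp (V j)" if "i \<le> j" "j \<le> k" for i j
    using that
  proof (induction j rule: dec_induct)
    case (step j)
    then have "supp (V j) \<subset> supp (V (Suc j))"
      by (intro sv_less_supp V(2)) simp
    then show ?case
      using step by auto
  qed simp
  have sep: "p j \<notin> supp (V (Suc i))" if "i < j" "j < k" for i j
    using mono[of "Suc i" j] pX(1)[of j] that by auto
  show thesis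
  proof
    show "triangular {..<k} X p"
      unfolding triangular_def
    proof (intro ballI conjI impI)
      fix i j assume "i \<in> {..<k}" "j \<in> {..<k}" "i < j"
      then show "p j \<notin> supp (X i)"
        using sep[of i j] pX(4)[of i] by blast
    qed (use pX in auto)
    show "p i \<in> E" if "i < k" for i
      using pX(2,3)[OF that] supp_ground by blast
    show "inj_on p {..<k}"
    proof (rule linorder_inj_onI)
      fix i j assume "i < j" "i \<in> {..<k}" "j \<in> {..<k}"
      then show "p i \<noteq> p j"
        using sep[of i j] pX(1)[of i] by auto
    qed auto
  qed
qed

text \<open>This bound makes the \<open>GREATEST\<close> in \<open>om_rank\<close> an attained
  maximum.\<close>

lemma chain_le_card:
  assumes "has_chain C k"
  shows "k \<le> card E"
  using chain_triangular[OF assms] card_inj_on_le[of _ "{..<k}" E] finite_ground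
  by (metis card_lessThan image_subsetI lessThan_iff)

lemma rank_chain: "has_chain C (om_rank C)"
  unfolding om_rank_def
proof (rule GreatestI_nat)
  show "has_chain C 0"
    unfolding has_chain_def covectors_def by auto
qed (use chain_le_card in blast)

text \<open>For \<open>ex_supp\<close>, a longest chain gives \<open>r\<close> rows in echelon form,
  while \<open>E - S\<close> has only \<open>r - 1\<close> elements. Clearing these leaves a row
  supported inside \<open>S\<close>, and equality follows by cardinality.\<close>

lemma uniform:
  assumes u: "uniform_om E C" and r: "2 \<le> om_rank C"
  shows "uniform_cocircuits E C (card E - om_rank C)"
proof
  let ?d = "card E - om_rank C"
  have le: "om_rank C \<le> card E"
    using chain_le_card rank_chain by blast
  show "card E = ?d + om_rank C"
    using le by simp
  show cs: "card (supp X) = Suc ?d" if X: "X \<in> C" for X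
  proof -
    have "supp X = E - zerop E X"
      using supp_ground[OF X] by (auto simp: zerop_def)
    moreover have "card (zerop E X) = om_rank C - 1"
      using u X by (simp add: uniform_om_def)
    ultimately show ?thesis
      using finite_ground le r by (simp add: card_Diff_subset zerop_def)
  qed
  show "\<exists>X\<in>C. supp X = S" if S: "S \<subseteq> E" "card S = Suc ?d" for S
  proof -
    obtain X p where "triangular {..<om_rank C} X p"
      using chain_triangular rank_chain by metis
    moreover have "finite (E - S)" "card (E - S) < om_rank C"
      using S finite_ground le r by (simp_all add: card_Diff_subset finite_subset)
    ultimately obtain J Y where J: "triangular J Y p" "card {..<om_rank C} \<le> card J + card (E - S)"
      "\<And>i s. i \<in> J \<Longrightarrow> s \<in> E - S \<Longrightarrow> s \<notin> supp (Y i)"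
      using gauss_elimination[of "E - S" "{..<om_rank C}" X p] by blast
    then obtain j where "j \<in> J"
      using \<open>card (E - S) < om_rank C\<close> by fastforce
    then have Y: "Y j \<in> C" "supp (Y j) \<subseteq> S"
      using J(1) J(3)[of j] supp_ground[of "Y j"] unfolding triangular_def by blast+
    then have "supp (Y j) = S"
      using card_subset_eq[OF finite_subset[OF S(1) finite_ground]] cs S(2) by metis
    then show ?thesis
      using Y by blast
  qed
  show "X = Y \<or> X = neg Y" if "X \<in> C" "Y \<in> C" "supp X = supp Y" for X Y
    using incomparable that by simp
qed (use finite_ground supp_ground neg_in elim r in blast)+

end

theorem theorem4p5:
  fixes E :: "'a set" and C :: "'a signvec set"
  assumes "oriented_matroid E C"
    and "uniform_om E C"
    and "om_rank C \<ge> 2"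
    and "card E - om_rank C \<le> 4"
  shows "cg_diam E C = enat (card E - om_rank C + 2)"
proof -
  interpret cocircuits E C
    by (rule cocircuits.intro) (rule assms(1))
  interpret uniform_cocircuits E C "card E - om_rank C"
    by (rule uniform) (rule assms)+
  show ?thesis
    using cg_diam_eq assms(4) by blast
qed

end
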